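(* Let $\mu$ be a Young diagram. (i) One has $$Fs_\mu=\sum_\nu c_{\mu\nu}\,s_\nu$$ with certain numerical coefficients $c_{\mu\nu}$, the sum being over the diagrams $\nu$ which are contained in $\mu$ and have the same number of diagonal squares as $\mu$. (ii) Write $\mu$ and $\nu$ in Frobenius notation, $\mu=(p_1,\dots,p_d\,|\,q_1,\dots,q_d)$ with $p_1>\dots>p_d\ge0$, $q_1>\dots>q_d\ge0$, and $\nu=(p'_1,\dots,p'_d\,|\,q'_1,\dots,q'_d)$ with $p'_1>\dots>p'_d\ge0$, $q'_1>\dots>q'_d\ge0$. Then $$c_{\mu\nu}=\det[c_{p_i,p'_j}]_{i,j=1}^d\;\det[c_{q_i,q'_j}]_{i,j=1}^d,$$ where for $p,p'=0,1,2,\dots$ $$c_{pp'}=\begin{cases}(-1)^{p-p'}e_{p-p'}(\tfrac12,\tfrac32,\dots,\tfrac{2p-1}2),&p'\le p,\\0,&p'>p,\end{cases}$$ and $e_k(\cdots)$ is the $k$-th elementary symmetric polynomial ($e_0=1$).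
   Context: The base field is $\mathbb C$. $\Lambda=\mathbb C[\mathbf p_1,\mathbf p_2,\dots]$ is the algebra of symmetric functions (polynomial ring in the power sums). Its elements $h_k$ are defined by $H(u)=1+\sum_{k\ge1}h_ku^{-k}=\exp\big(\sum_{k\ge1}\mathbf p_ku^{-k}/k\big)\in\Lambda[[u^{-1}]]$, with $h_0=1$ and $h_k=0$ for $k<0$. The Schur function is $s_\nu=\det[h_{\nu_i-i+j}]$ (order any number $\ge\ell(\nu)$). Frobenius notation: $\mu=(p_1,\dots,p_d\,|\,q_1,\dots,q_d)$ where $d$ is the number of diagonal squares of $\mu$, $p_i=\mu_i-i$, $q_i=\mu'_i-i$, $\mu'$ the transposed diagram. Shifted symmetric functions: $\Lambda^*_n\subset\mathbb C[x_1,\dots,x_n]$ is the algebra of polynomials symmetric in the variables $x_j-j$, and $\Lambda^*=\varprojlim\Lambda^*_n$ is the projective limit in filtered algebras (filtration by degree) under the maps $x_n=0$. Put $x^{\downarrow m}=x(x-1)\cdots(x-m+1)$, $x^{\downarrow0}=1$. The shifted Schur function $s^*_\mu\in\Lambda^*$ is given for $n\ge\ell(\mu)$ by $$s^*_\mu(x_1,\dots,x_n)=\frac{\det[(x_i+n-i)^{\downarrow(\mu_j+n-j)}]_{i,j=1}^n}{\det[(x_i+n-i)^{\downarrow(n-j)}]_{i,j=1}^n}$$ (these are compatible for varying $n$). Put $h^*_k=s^*_{(k)}$ and $H^*(u)=1+\sum_{k\ge1}h^*_k/u^{\downarrow k}\in\Lambda^*[[u^{-1}]]$. $\Lambda^*$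 is the polynomial algebra in $h_1^*,h_2^*,\dots$, and $\varphi:\Lambda^*\to\Lambda$ is the algebra isomorphism defined (coefficientwise in $u^{-1}$) by $\varphi(H^*(u))=H(u+\tfrac12)$. The Frobenius--Schur function is $Fs_\mu=\varphi(s^*_\mu)$. *)

theory Defs
  imports
    Complex_Main
    "HOL-Library.Poly_Mapping"
    "HOL-Combinatorics.Permutations"
    "HOL-Computational_Algebra.Formal_Power_Series"
    "Jordan_Normal_Form.Determinant"
begin

section \<open>Young diagrams\<close>

definition young :: "nat list \<Rightarrow> bool" where
  "young \<mu> \<longleftrightarrow> sorted_wrt (\<ge>) \<mu> \<and> 0 \<notin> set \<mu>"

text \<open>Rows and columns are numbered from 1; rows beyond the last one have length 0.\<close>

definition row :: "nat list \<Rightarrow> nat \<Rightarrow> nat" where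
  "row \<mu> i = (if 1 \<le> i \<and> i \<le> length \<mu> then \<mu> ! (i - 1) else 0)"

definition column :: "nat list \<Rightarrow> nat \<Rightarrow> nat" where
  "column \<mu> j = card {i \<in> {1..length \<mu>}. j \<le> row \<mu> i}"

definition contained :: "nat list \<Rightarrow> nat list \<Rightarrow> bool" where
  "contained \<nu> \<mu> \<longleftrightarrow> (\<forall>i. row \<nu> i \<le> row \<mu> i)"

definition diag_squares :: "nat list \<Rightarrow> nat" where
  "diag_squares \<mu> = card {i \<in> {1..length \<mu>}. i \<le> row \<mu> i}"

text \<open>The Frobenius coordinates $p_i$, $q_i$, meaningful for $1 \le i \le d$, where $d$ is the
  number of diagonal squares; there the natural-number subtractions do not truncate.\<close>

definition frob_p :: "nat list \<Rightarrow> nat \<Rightarrow> nat" where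
  "frob_p \<mu> i = row \<mu> i - i"

definition frob_q :: "nat list \<Rightarrow> nat \<Rightarrow> nat" where
  "frob_q \<mu> i = column \<mu> i - i"

definition subdiagrams_same_diag :: "nat list \<Rightarrow> nat list set" where
  "subdiagrams_same_diag \<mu> =
     {\<nu>. young \<nu> \<and> contained \<nu> \<mu> \<and> diag_squares \<nu> = diag_squares \<mu>}"

lemma finite_subdiagrams_same_diag: "finite (subdiagrams_same_diag \<mu>)"
proof (rule finite_subset)
  show "finite {xs. set xs \<subseteq> {..sum_list \<mu>} \<and> length xs \<le> length \<mu>}"
    by (rule finite_lists_length_le) simp
next
  show "subdiagrams_same_diag \<mu> \<subseteq> {xs. set xs \<subseteq> {..sum_list \<mu>} \<and> length xs \<le> length \<mu>}"
  proof
    fix \<nu> assume "\<nu> \<in> subdiagrams_same_diag \<mu>"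
    then have y: "0 \<notin> set \<nu>" and c: "\<And>i. row \<nu> i \<le> row \<mu> i"
      by (auto simp: subdiagrams_same_diag_def young_def contained_def)
    have nth: "i < length \<mu> \<and> \<nu> ! i \<le> \<mu> ! i" if i: "i < length \<nu>" for i
    proof -
      from y i have "\<nu> ! i \<noteq> 0" by (metis nth_mem)
      then show ?thesis using c[of "Suc i"] i by (auto simp: row_def split: if_splits)
    qed
    then have "length \<nu> \<le> length \<mu>" by (meson not_less less_irrefl)
    moreover have "set \<nu> \<subseteq> {..sum_list \<mu>}"
    proof
      fix x assume "x \<in> set \<nu>"
      then obtain i where "i < length \<nu>" "x = \<nu> ! i" by (auto simp: in_set_conv_nth)
      with nth[of i] have "x \<le> \<mu> ! i" "\<mu> ! i \<in> set \<mu>" by auto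
      then show "x \<in> {..sum_list \<mu>}" using member_le_sum_list[of "\<mu> ! i" \<mu>] by simp
    qed
    ultimately show "\<nu> \<in> {xs. set xs \<subseteq> {..sum_list \<mu>} \<and> length xs \<le> length \<mu>}" by blast
  qed
qed


section \<open>Polynomials in countably many variables\<close>

type_synonym cpoly = "(nat \<Rightarrow>\<^sub>0 nat) \<Rightarrow>\<^sub>0 complex"

definition const :: "complex \<Rightarrow> cpoly" where
  "const c = Poly_Mapping.single 0 c"

definition var :: "nat \<Rightarrow> cpoly" where
  "var i = Poly_Mapping.single (Poly_Mapping.single i 1) 1"

definition subst_poly :: "(nat \<Rightarrow> cpoly) \<Rightarrow> cpoly \<Rightarrow> cpoly" where
  "subst_poly \<sigma> f =
     (\<Sum>m \<in> Poly_Mapping.keys f. const (Poly_Mapping.lookup f m) *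
        (\<Prod>i \<in> Poly_Mapping.keys m. \<sigma> i ^ Poly_Mapping.lookup m i))"

definition poly_vars :: "cpoly \<Rightarrow> nat set" where
  "poly_vars f = (\<Union>m \<in> Poly_Mapping.keys f. Poly_Mapping.keys m)"

definition degree_le :: "nat \<Rightarrow> cpoly \<Rightarrow> bool" where
  "degree_le D f \<longleftrightarrow>
     (\<forall>m \<in> Poly_Mapping.keys f. (\<Sum>i \<in> Poly_Mapping.keys m. Poly_Mapping.lookup m i) \<le> D)"

definition falling :: "'a::comm_ring_1 \<Rightarrow> nat \<Rightarrow> 'a" where
  "falling x m = (\<Prod>k<m. x - of_nat k)"


section \<open>Symmetric functions\<close>

text \<open>The algebra $\Lambda$ is the whole type \<^typ>\<open>cpoly\<close>; its free generators
  $\mathbf p_1, \mathbf p_2, \dots$ are the variables with indices $0, 1, \dots$\<close>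

definition powersum :: "nat \<Rightarrow> cpoly" where
  "powersum k = var (k - 1)"

text \<open>Series in $u^{-1}$ are formal power series whose variable stands for $u^{-1}$. The
  composition below is $\exp(\sum_{k \ge 1} \mathbf p_k u^{-k}/k)$.\<close>

definition H_series :: "cpoly fps" where
  "H_series = Abs_fps (\<lambda>m. const (1 / fact m)) oo
     Abs_fps (\<lambda>k. if k = 0 then 0 else const (1 / of_nat k) * powersum k)"

definition hsym :: "int \<Rightarrow> cpoly" where
  "hsym k = (if k < 0 then 0 else fps_nth H_series (nat k))"

definition schur :: "nat list \<Rightarrow> cpoly" where
  "schur \<nu> = det (mat (length \<nu>) (length \<nu>)
     (\<lambda>(i, j). hsym (int (row \<nu> (i + 1)) - int (i + 1) + int (j + 1))))"

text \<open>The expansion of $(u + \frac12)^{-1}$ in powers of $u^{-1}$, and $H(u + \frac12)$.\<close>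

definition inv_u_plus_half :: "complex fps" where
  "inv_u_plus_half = fps_X / (1 + fps_const (1/2) * fps_X)"

definition H_shifted :: "cpoly fps" where
  "H_shifted = H_series oo Abs_fps (\<lambda>n. const (fps_nth inv_u_plus_half n))"


section \<open>Shifted symmetric functions\<close>

text \<open>In this part the variables $x_1, x_2, \dots$ are the variables with indices $1, 2, \dots$\<close>

definition sympoly :: "nat \<Rightarrow> cpoly set" where
  "sympoly n = {g. poly_vars g \<subseteq> {1..n} \<and>
     (\<forall>\<pi>. \<pi> permutes {1..n} \<longrightarrow> subst_poly (\<lambda>i. var (\<pi> i)) g = g)}"

definition Lambda_star_n :: "nat \<Rightarrow> cpoly set" where
  "Lambda_star_n n = (\<lambda>g. subst_poly (\<lambda>j. var j - of_nat j) g) ` sympoly n"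

text \<open>The projective limit $\Lambda^*$ in the category of filtered algebras consists of the
  compatible sequences of uniformly bounded degree. All its algebra operations are
  componentwise.\<close>

definition Lambda_star :: "(nat \<Rightarrow> cpoly) set" where
  "Lambda_star = {f. (\<forall>n. f n \<in> Lambda_star_n n) \<and>
     (\<forall>n. subst_poly (var(Suc n := 0)) (f (Suc n)) = f n) \<and>
     (\<exists>D. \<forall>n. degree_le D (f n))}"

definition alternant :: "nat list \<Rightarrow> nat \<Rightarrow> cpoly" where
  "alternant \<mu> n = det (mat n n
     (\<lambda>(i, j). falling (var (i + 1) + of_nat (n - (i + 1))) (row \<mu> (j + 1) + n - (j + 1))))"

text \<open>The quotient of determinants is expressed by multiplying out the denominator, which is a
  nonzero element of an integral domain. Components with fewer than $\ell(\mu)$ variables are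
  determined by compatibility.\<close>

definition shifted_schur :: "nat list \<Rightarrow> (nat \<Rightarrow> cpoly)" where
  "shifted_schur \<mu> = (THE f. f \<in> Lambda_star \<and>
     (\<forall>n \<ge> length \<mu>. f n * alternant [] n = alternant \<mu> n))"

definition hstar :: "nat \<Rightarrow> (nat \<Rightarrow> cpoly)" where
  "hstar k = shifted_schur [k]"

text \<open>The expansion of $1/u^{\downarrow k} = \prod_{i<k} (u - i)^{-1}$ in powers of $u^{-1}$.\<close>

definition inv_falling :: "nat \<Rightarrow> complex fps" where
  "inv_falling k = (\<Prod>i<k. fps_X / (1 - fps_const (of_nat i) * fps_X))"

text \<open>The coefficient of $u^{-m}$ in $H^*(u)$; as $1/u^{\downarrow k}$ has order $u^{-k}$, only
  the terms with $k \le m$ contribute.\<close>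

definition Hstar_coeff :: "nat \<Rightarrow> (nat \<Rightarrow> cpoly)" where
  "Hstar_coeff m = (\<lambda>n. (if m = 0 then 1 else 0) +
     (\<Sum>k = 1..m. const (fps_nth (inv_falling k) m) * hstar k n))"


section \<open>The isomorphism and the Frobenius--Schur functions\<close>

definition algebra_iso :: "((nat \<Rightarrow> cpoly) \<Rightarrow> cpoly) \<Rightarrow> bool" where
  "algebra_iso \<phi> \<longleftrightarrow>
     bij_betw \<phi> Lambda_star UNIV \<and>
     \<phi> (\<lambda>n. 1) = 1 \<and>
     (\<forall>f \<in> Lambda_star. \<forall>g \<in> Lambda_star. \<phi> (\<lambda>n. f n + g n) = \<phi> f + \<phi> g) \<and>
     (\<forall>f \<in> Lambda_star. \<forall>g \<in> Lambda_star. \<phi> (\<lambda>n. f n * g n) = \<phi> f * \<phi> g) \<and>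
     (\<forall>a. \<forall>f \<in> Lambda_star. \<phi> (\<lambda>n. const a * f n) = const a * \<phi> f)"

text \<open>The conditions below determine the isomorphism uniquely on $\Lambda^*$, because the
  elements $h^*_k$ are free generators of $\Lambda^*$.\<close>

definition frobenius_schur_iso :: "((nat \<Rightarrow> cpoly) \<Rightarrow> cpoly) \<Rightarrow> bool" where
  "frobenius_schur_iso \<phi> \<longleftrightarrow>
     algebra_iso \<phi> \<and> (\<forall>m. \<phi> (Hstar_coeff m) = fps_nth H_shifted m)"

definition frobenius_schur :: "((nat \<Rightarrow> cpoly) \<Rightarrow> cpoly) \<Rightarrow> nat list \<Rightarrow> cpoly" where
  "frobenius_schur \<phi> \<mu> = \<phi> (shifted_schur \<mu>)"


section \<open>The coefficients\<close>

definition esym :: "nat \<Rightarrow> 'b set \<Rightarrow> ('b \<Rightarrow> complex) \<Rightarrow> complex" where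
  "esym k I a = (\<Sum>X | X \<subseteq> I \<and> card X = k. \<Prod>i \<in> X. a i)"

definition hook_coeff :: "nat \<Rightarrow> nat \<Rightarrow> complex" where
  "hook_coeff p p' = (if p' \<le> p
     then (-1) ^ (p - p') * esym (p - p') {1..p} (\<lambda>i. (2 * of_nat i - 1) / 2) else 0)"

end

theory Submission
  imports Defs "HOL-Library.FuncSet"
begin

text \<open>
For an integer $k$ let $b_k(u) = (u - \frac12)^{\downarrow k}$, where for $k = -m < 0$ this means
$1/((u + \frac12)(u + \frac32)\cdots(u + m - \frac12))$. Put $k_j = \mu_j - j$ and take
$n \ge \ell(\mu)$. The Schur function $s_\mu$ is the $n \times n$ determinant of the coefficients of
$u^{-1}$ in $u^{k_j} u^{i-1} H(u)$. The Frobenius--Schur function is the same determinant with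
$u^{k_j}$ replaced by $b_{k_j}(u)$ (\<open>frobenius_schur_eq\<close>). Behind the second formula is
an explicit series in $n$ variables,
$\prod_{i \le n} (u + i - \frac12)/(u + i - \frac12 - x_i)$. Its coefficients lie in $\Lambda^*$.
Multiplying the Jacobi--Trudi matrix formed from it by a matrix that does not depend on $\mu$ gives
the numerator of the defining quotient of determinants (\<open>alternant_eq_jacobi_trudi\<close>).
The series is $H^*(u - \frac12)$, so that $\varphi$ sends it to $H(u)$.

What remains is a change of rows from $u^k$ to $b_k(u)$. For $k \ge 0$ the function $b_k$ is a
polynomial and its coefficients are the numbers $c_{kk'}$. For $k < 0$ it involves only negative
powers of $u$. So the transition matrix has a nonnegative and a negative block that do not
mix, which is why the number of diagonal squares is preserved. Since the coefficient of $u^{-1}$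
pairs the reciprocals $b_{-q-1}$ dually with the polynomials
$(u + \frac12)\cdots(u + q - \frac12)$, the inverse of the negative block is, up to signs and
transposition, again the matrix $(c_{qq'})$ (\<open>dual_falling_nth\<close>).

In Frobenius notation the nonnegative $k_j$ are $p_1, \dots, p_d$, and the negative values
$-1, \dots, -n$ that do not occur among the $k_j$ are $-q_i - 1$ (\<open>frobenius_rows_young\<close>).
If the rows with negative index are normalised to unit vectors, the $n \times n$ determinant becomes,
up to sign, a $d \times d$ minor with rows $p_i$ and columns $q_j$ (\<open>giambelli_rows\<close>). The
normalised matrices of the two families differ by a factor $(c_{pp'})$ on the left and a factor
$((-1)^{q + q'} c_{qq'})$, transposed, on the right. Applying the Cauchy--Binet formula on both sides
(\<open>block_change_of_rows\<close>) gives a sum over pairs $(p' | q')$, that is, over diagrams $\nu$.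
All signs cancel. By triangularity of $(c_{pp'})$ only those $\nu$ contribute for which
$p'_i \le p_i$ and $q'_i \le q_i$, and these are contained in $\mu$.
\<close>


section \<open>Determinants of functions of two indices\<close>

text \<open>Determinants whose size and entries vary in one formula are easier to handle with entries given
by a function on pairs of indices than with matrices that carry their dimensions.\<close>

definition fdet :: "nat \<Rightarrow> (nat \<Rightarrow> nat \<Rightarrow> 'a) \<Rightarrow> 'a::comm_ring_1" where
  "fdet n f = det (mat n n (\<lambda>(i, j). f i j))"

lemma fdet_expand:
  "fdet n f = (\<Sum>\<pi> | \<pi> permutes {..<n}. of_int (sign \<pi>) * (\<Prod>i<n. f i (\<pi> i)))"
proof -
  have "fdet n f = (\<Sum>\<pi> | \<pi> permutes {..<n}. of_int (sign \<pi>) * (\<Prod>i<n. mat n n (\<lambda>(i, j). f i j) $$ (i, \<pi> i)))"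
    unfolding fdet_def by (subst det_def'[of _ n]) (auto simp: atLeast0LessThan)
  also have "\<dots> = (\<Sum>\<pi> | \<pi> permutes {..<n}. of_int (sign \<pi>) * (\<Prod>i<n. f i (\<pi> i)))"
  proof (intro sum.cong refl arg_cong2[of _ _ _ _ "(*)"] prod.cong)
    fix \<pi> i assume "\<pi> \<in> {\<pi>. \<pi> permutes {..<n}}" "i \<in> {..<n}"
    then show "mat n n (\<lambda>(i, j). f i j) $$ (i, \<pi> i) = f i (\<pi> i)"
      using permutes_in_image[of \<pi> "{..<n}" i] by auto
  qed
  finally show ?thesis .
qed

lemma fdet_cong:
  assumes "\<And>i j. i < n \<Longrightarrow> j < n \<Longrightarrow> f i j = g i j"
  shows "fdet n f = fdet n g"
  unfolding fdet_def by (rule arg_cong[where f = det]) (auto intro!: eq_matI simp: assms)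

lemma fdet_transpose: "fdet n (\<lambda>i j. f j i) = fdet n f"
proof -
  have "mat n n (\<lambda>(i, j). f j i) = transpose_mat (mat n n (\<lambda>(i, j). f i j))"
    by (auto intro!: eq_matI)
  then show ?thesis unfolding fdet_def by (simp add: det_transpose[of _ n])
qed

lemma fdet_mult: "fdet n f * fdet n g = fdet n (\<lambda>i j. \<Sum>k<n. f i k * g k j)"
proof -
  have "mat n n (\<lambda>(i, j). \<Sum>k<n. f i k * g k j) = mat n n (\<lambda>(i, j). f i j) * mat n n (\<lambda>(i, j). g i j)"
    by (auto intro!: eq_matI simp: scalar_prod_def atLeast0LessThan)
  then show ?thesis unfolding fdet_def by (simp add: det_mult[of _ n])
qed

lemma fdet_permute_rows:
  assumes "\<pi> permutes {..<n}"
  shows "fdet n (\<lambda>i j. f (\<pi> i) j) = of_int (sign \<pi>) * fdet n f"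
proof -
  have "fdet n (\<lambda>i j. f (\<pi> i) j) = fdet n (\<lambda>i j. mat n n (\<lambda>(i, j). f i j) $$ (\<pi> i, j))"
    using assms permutes_in_image[OF assms] by (intro fdet_cong) auto
  also have "\<dots> = of_int (sign \<pi>) * fdet n f"
    unfolding fdet_def using assms by (subst det_permute_rows) (auto simp: atLeast0LessThan)
  finally show ?thesis .
qed

lemma fdet_equal_rows:
  assumes "i < n" "i' < n" "i \<noteq> i'" "\<And>j. j < n \<Longrightarrow> f i j = f i' j"
  shows "fdet n f = 0"
  unfolding fdet_def
  by (rule det_identical_rows[of _ n i i']) (use assms in \<open>auto intro!: eq_vecI\<close>)

lemma fdet_last_row_unit:
  assumes "c \<le> n" "\<And>j. j \<le> n \<Longrightarrow> f n j = (if j = c then 1 else 0)"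
  shows "fdet (Suc n) f = (-1) ^ (n + c) * fdet n (\<lambda>i j. f i (if j < c then j else Suc j))"
proof -
  let ?A = "mat (Suc n) (Suc n) (\<lambda>(i, j). f i j)"
  have "fdet (Suc n) f = (\<Sum>j<Suc n. ?A $$ (n, j) * cofactor ?A n j)"
    unfolding fdet_def by (rule laplace_expansion_row) auto
  also have "\<dots> = (\<Sum>j<Suc n. if j = c then cofactor ?A n j else 0)"
    by (intro sum.cong refl) (auto simp: assms)
  also have "\<dots> = cofactor ?A n c" using assms(1) by (subst sum.delta) auto
  also have "\<dots> = (-1) ^ (n + c) * fdet n (\<lambda>i j. f i (if j < c then j else Suc j))"
    unfolding cofactor_def mat_delete_def fdet_def
    by (intro arg_cong2[of _ _ _ _ "(*)"] refl arg_cong[where f = det]) (use assms(1) in \<open>auto intro!: eq_matI\<close>)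
  finally show ?thesis .
qed

lemma fdet_upper_triangular:
  assumes "\<And>i j. j < i \<Longrightarrow> i < n \<Longrightarrow> f i j = 0"
  shows "fdet n f = (\<Prod>i<n. f i i)"
proof -
  have "fdet n f = prod_list (diag_mat (mat n n (\<lambda>(i, j). f i j)))"
    unfolding fdet_def by (rule det_upper_triangular[of _ n]) (auto simp: assms upper_triangular_def)
  also have "\<dots> = (\<Prod>i<n. f i i)"
    unfolding diag_mat_def by (subst prod.list_conv_set_nth) (auto simp: atLeast0LessThan)
  finally show ?thesis .
qed

lemma fdet_scale: "fdet n (\<lambda>i j. a i * b j * f i j) = (\<Prod>i<n. a i) * (\<Prod>i<n. b i) * fdet n f"
proof -
  have p: "(\<Prod>i<n. b (\<pi> i)) = (\<Prod>i<n. b i)" if "\<pi> permutes {..<n}" for \<pi>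
    using prod.permute[OF that, of b] by (simp add: o_def)
  show ?thesis
    unfolding fdet_expand sum_distrib_left
    by (intro sum.cong refl) (simp add: prod.distrib p mult_ac)
qed

lemma fdet_hom:
  assumes "\<And>a b. h (a + b) = h a + h b" "\<And>a b. h (a * b) = h a * h b" "h 1 = 1" "h 0 = 0"
  shows "h (fdet n f :: 'a::comm_ring_1) = (fdet n (\<lambda>i j. h (f i j)) :: 'b::comm_ring_1)"
proof -
  have sum: "h (sum g S) = (\<Sum>x\<in>S. h (g x))" for g and S :: "(nat \<Rightarrow> nat) set"
    by (induction S rule: infinite_finite_induct) (simp_all add: assms)
  have prod: "h (prod g S) = (\<Prod>x\<in>S. h (g x))" for g and S :: "nat set"
    by (induction S rule: infinite_finite_induct) (simp_all add: assms)
  have "h (- 1) + 1 = 0" using assms(1)[of "- 1" 1] by (simp add: assms)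
  then have "h (- 1) = - 1" by (simp add: eq_neg_iff_add_eq_0)
  then have "h (of_int (sign \<pi>)) = of_int (sign \<pi>)" for \<pi> :: "nat \<Rightarrow> nat"
    by (cases \<pi> rule: sign_cases) (simp_all add: assms)
  then show ?thesis unfolding fdet_expand by (simp add: sum prod assms)
qed

text \<open>With determinant $1$ the adjugate is an inverse over any commutative ring.\<close>

lemma fdet_inverse:
  fixes f :: "nat \<Rightarrow> nat \<Rightarrow> 'a::comm_ring_1"
  assumes "fdet n f = 1"
  obtains W where "\<And>q c. q < n \<Longrightarrow> c < n \<Longrightarrow> (\<Sum>i<n. f q i * W i c) = (if c = q then 1 else 0)" "fdet n W = 1"
proof -
  let ?A = "mat n n (\<lambda>(i, j). f i j)"
  define W where "W = (\<lambda>i c. adj_mat ?A $$ (i, c))"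
  have adj: "adj_mat ?A \<in> carrier_mat n n" and prod: "?A * adj_mat ?A = 1\<^sub>m n"
    using adj_mat(1,2)[of ?A n] assms by (auto simp: fdet_def)
  have inv: "(\<Sum>i<n. f q i * W i c) = (if c = q then 1 else 0)" if "q < n" "c < n" for q c
  proof -
    have "(\<Sum>i<n. f q i * W i c) = (?A * adj_mat ?A) $$ (q, c)"
      using that adj by (auto simp: W_def scalar_prod_def atLeast0LessThan)
    then show ?thesis unfolding prod using that by simp
  qed
  have "fdet n f * fdet n W = fdet n (\<lambda>q c. if c = q then 1 else 0)"
    unfolding fdet_mult by (intro fdet_cong) (simp add: inv)
  also have "\<dots> = 1" by (subst fdet_upper_triangular) auto
  finally have "fdet n W = 1" using assms by simp
  with inv show ?thesis using that by blast
qed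


section \<open>The Cauchy--Binet formula over decreasing sequences\<close>

text \<open>A decreasing sequence enumerates its set of values in the order used by Frobenius coordinates.
The sequences are extensional, so they correspond to the $d$-element subsets of $\{0, \dots, N - 1\}$
one to one.\<close>

definition decreasing_seqs :: "nat \<Rightarrow> nat \<Rightarrow> (nat \<Rightarrow> nat) set" where
  "decreasing_seqs d N = {f \<in> {..<d} \<rightarrow>\<^sub>E {..<N}. \<forall>i j. i < j \<longrightarrow> j < d \<longrightarrow> f j < f i}"

lemma finite_decreasing_seqs [simp]: "finite (decreasing_seqs d N)"
proof (rule finite_subset)
  show "decreasing_seqs d N \<subseteq> {..<d} \<rightarrow>\<^sub>E {..<N}" unfolding decreasing_seqs_def by blast
  show "finite ({..<d} \<rightarrow>\<^sub>E {..<N})" by (intro finite_PiE) simp_all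
qed

lemma decreasing_unique:
  fixes f g :: "nat \<Rightarrow> nat"
  assumes "\<And>i j. i < j \<Longrightarrow> j < d \<Longrightarrow> f j < f i" "\<And>i j. i < j \<Longrightarrow> j < d \<Longrightarrow> g j < g i"
    and "f ` {..<d} = g ` {..<d}" and "i < d"
  shows "f i = g i"
proof -
  have "rev (map f [0..<d]) = rev (map g [0..<d])"
    by (rule strict_sorted_equal)
      (use assms(1-3) in \<open>unfold sorted_wrt_rev sorted_wrt_map, auto simp: sorted_wrt_iff_nth_less atLeast0LessThan\<close>)
  then have "map f [0..<d] ! i = map g [0..<d] ! i" by (simp only: rev_is_rev_conv)
  then show ?thesis using assms(4) by simp
qed

lemma decreasing_inj_on:
  fixes f :: "nat \<Rightarrow> nat"
  assumes "\<And>i j. i < j \<Longrightarrow> j < d \<Longrightarrow> f j < f i"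
  shows "inj_on f {..<d}"
proof (rule inj_onI)
  fix x y assume "x \<in> {..<d}" "y \<in> {..<d}" "f x = f y"
  then show "x = y" using assms[of x y] assms[of y x] by (cases x y rule: linorder_cases) auto
qed

lemma decreasing_seqs_D:
  assumes "f \<in> decreasing_seqs d N"
  shows "\<And>i j. i < j \<Longrightarrow> j < d \<Longrightarrow> f j < f i" "\<And>i. i < d \<Longrightarrow> f i < N" "f \<in> extensional {..<d}" "inj_on f {..<d}"
proof -
  show 1: "\<And>i j. i < j \<Longrightarrow> j < d \<Longrightarrow> f j < f i" and "\<And>i. i < d \<Longrightarrow> f i < N" and "f \<in> extensional {..<d}"
    using assms unfolding decreasing_seqs_def by (auto simp: PiE_iff)
  show "inj_on f {..<d}" by (rule decreasing_inj_on) (rule 1)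
qed

lemma decreasing_enumeration:
  fixes S :: "nat set"
  assumes "finite S"
  obtains g where "\<And>i j. i < j \<Longrightarrow> j < card S \<Longrightarrow> g j < g i" "g ` {..<card S} = S"
proof
  let ?xs = "rev (sorted_list_of_set S)"
  have l: "length ?xs = card S" by simp
  show "?xs ! j < ?xs ! i" if "i < j" "j < card S" for i j
    using that sorted_wrt_nth_less[of "(>)" ?xs i j] by (simp add: sorted_wrt_rev)
  have "(\<lambda>i. ?xs ! i) ` {..<card S} = set ?xs"
    unfolding set_conv_nth l by auto
  then show "(\<lambda>i. ?xs ! i) ` {..<card S} = S" using assms by simp
qed

text \<open>Multilinearity in the rows expands the left-hand side over all maps $f$ from row indices to the
summation range. A map that is not injective contributes a determinant with two equal rows.
An injective one is uniquely $g \circ \pi$ with $g$ decreasing and $\pi$ a permutation, and summing over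
$\pi$ rebuilds the first determinant.\<close>

lemma cauchy_binet:
  fixes A B :: "nat \<Rightarrow> nat \<Rightarrow> 'a::comm_ring_1"
  shows "fdet d (\<lambda>i j. \<Sum>k<N. A i k * B k j) =
    (\<Sum>f \<in> decreasing_seqs d N. fdet d (\<lambda>i j. A i (f j)) * fdet d (\<lambda>i j. B (f i) j))"
proof -
  let ?P = "{\<pi>. \<pi> permutes {..<d}}" and ?F = "{..<d} \<rightarrow>\<^sub>E {..<N}"
  let ?W = "\<lambda>f. (\<Prod>i<d. A i (f i)) * fdet d (\<lambda>i j. B (f i) j)"
  let ?h = "\<lambda>(g, \<pi>). restrict (g \<circ> \<pi>) {..<d}"
  have finF: "finite ?F" by (intro finite_PiE) auto
  have "fdet d (\<lambda>i j. \<Sum>k<N. A i k * B k j) =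
      (\<Sum>\<pi>\<in>?P. of_int (sign \<pi>) * (\<Sum>f\<in>?F. \<Prod>i<d. A i (f i) * B (f i) (\<pi> i)))"
    unfolding fdet_expand by (subst prod_sum_PiE) auto
  also have "\<dots> = (\<Sum>f\<in>?F. ?W f)"
    unfolding fdet_expand sum_distrib_left
    by (subst sum.swap) (simp add: prod.distrib mult_ac)
  also have "\<dots> = (\<Sum>f\<in>{f\<in>?F. inj_on f {..<d}}. ?W f)"
  proof (rule sum.mono_neutral_right[OF finF], blast, intro ballI)
    fix f assume "f \<in> ?F - {f \<in> ?F. inj_on f {..<d}}"
    then obtain i j where "i < d" "j < d" "i \<noteq> j" "f i = f j" by (auto simp: inj_on_def)
    then have "fdet d (\<lambda>i j. B (f i) j) = 0" by (intro fdet_equal_rows[of i d j]) auto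
    then show "?W f = 0" by simp
  qed
  also have "\<dots> = (\<Sum>(g, \<pi>)\<in>decreasing_seqs d N \<times> ?P. ?W (?h (g, \<pi>)))"
  proof (rule sum.reindex_bij_betw[symmetric, THEN trans])
    show "bij_betw ?h (decreasing_seqs d N \<times> ?P) {f\<in>?F. inj_on f {..<d}}"
      unfolding bij_betw_def
    proof (intro conjI subset_antisym subsetI)
      show "inj_on ?h (decreasing_seqs d N \<times> ?P)"
      proof (rule inj_onI, clarify)
        fix g \<pi> g' \<pi>'
        assume g: "g \<in> decreasing_seqs d N" and g': "g' \<in> decreasing_seqs d N"
          and p: "\<pi> permutes {..<d}" and p': "\<pi>' permutes {..<d}"
          and eq: "restrict (g \<circ> \<pi>) {..<d} = restrict (g' \<circ> \<pi>') {..<d}"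
        have eq': "g (\<pi> i) = g' (\<pi>' i)" if "i < d" for i
          using fun_cong[OF eq, of i] that by simp
        have "g ` {..<d} = (\<lambda>i. g (\<pi> i)) ` {..<d}"
          using permutes_image[OF p] by (metis image_image)
        also have "\<dots> = (\<lambda>i. g' (\<pi>' i)) ` {..<d}" using eq' by auto
        also have "\<dots> = g' ` {..<d}" using permutes_image[OF p'] by (metis image_image)
        finally have im: "g ` {..<d} = g' ` {..<d}" .
        have "g i = g' i" if "i < d" for i
          by (rule decreasing_unique[OF decreasing_seqs_D(1)[OF g] decreasing_seqs_D(1)[OF g'] im that])
        then have gg: "g = g'"
          by (intro extensionalityI[OF decreasing_seqs_D(3)[OF g] decreasing_seqs_D(3)[OF g']]) auto
        have "\<pi> i = \<pi>' i" for i
        proof (cases "i < d")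
          case True
          then show ?thesis
            using eq'[OF True] decreasing_seqs_D(4)[OF g] permutes_in_image[OF p, of i] permutes_in_image[OF p', of i]
            by (auto simp: gg inj_on_def)
        next
          case False
          then show ?thesis using permutes_not_in[OF p, of i] permutes_not_in[OF p', of i] by simp
        qed
        then show "g = g' \<and> \<pi> = \<pi>'" using gg by auto
      qed
    next
      fix f assume "f \<in> ?h ` (decreasing_seqs d N \<times> ?P)"
      then obtain g \<pi> where g: "g \<in> decreasing_seqs d N" and p: "\<pi> permutes {..<d}" and f: "f = restrict (g \<circ> \<pi>) {..<d}"
        by auto
      have pd: "\<pi> i < d" if "i < d" for i using permutes_in_image[OF p, of i] that by simp
      have "inj_on (g \<circ> \<pi>) {..<d}"
        using permutes_inj_on[OF p] decreasing_seqs_D(4)[OF g] permutes_image[OF p]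
        by (intro comp_inj_on) auto
      moreover have "f \<in> ?F" unfolding f using decreasing_seqs_D(2)[OF g pd] by (auto intro!: PiE_I)
      ultimately show "f \<in> {f\<in>?F. inj_on f {..<d}}" unfolding f by simp
    next
      fix f assume f: "f \<in> {f\<in>?F. inj_on f {..<d}}"
      then have fN: "\<And>i. i < d \<Longrightarrow> f i < N" and inj: "inj_on f {..<d}" and ext: "f \<in> extensional {..<d}"
        by (auto simp: PiE_def Pi_def)
      obtain g0 where g0: "\<And>i j. i < j \<Longrightarrow> j < card (f ` {..<d}) \<Longrightarrow> g0 j < g0 i"
        "g0 ` {..<card (f ` {..<d})} = f ` {..<d}"
        using decreasing_enumeration[of "f ` {..<d}"] by auto
      have cd: "card (f ` {..<d}) = d" using card_image[OF inj] by simp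
      define g where "g = restrict g0 {..<d}"
      have gim: "g ` {..<d} = f ` {..<d}" using g0(2) unfolding cd g_def by auto
      have g: "g \<in> decreasing_seqs d N"
        unfolding decreasing_seqs_def
      proof (intro CollectI conjI allI impI PiE_I)
        show "g i \<in> {..<N}" if "i \<in> {..<d}" for i
          using imageI[OF that, of g] fN unfolding gim by auto
        show "g j < g i" if "i < j" "j < d" for i j using g0(1)[of i j] that unfolding cd g_def by simp
      qed (simp add: g_def)
      have ginj: "inj_on g {..<d}" using decreasing_seqs_D(4)[OF g] .
      \<comment> \<open>The values of \<open>f\<close> are sorted by \<open>g\<close>; the permutation records their original places.\<close>
      define \<pi> where "\<pi> = (\<lambda>i. if i < d then inv_into {..<d} g (f i) else i)"
      have pm: "\<pi> i < d \<and> g (\<pi> i) = f i" if "i < d" for i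
      proof -
        have "f i \<in> g ` {..<d}" using that gim by auto
        then show ?thesis using that inv_into_into[of "f i" g "{..<d}"] f_inv_into_f[of "f i" g "{..<d}"]
          by (auto simp: \<pi>_def)
      qed
      have "inj_on \<pi> {..<d}"
      proof (rule inj_onI)
        fix x y assume "x \<in> {..<d}" "y \<in> {..<d}" "\<pi> x = \<pi> y"
        then show "x = y" using pm[of x] pm[of y] inj by (auto dest: inj_onD)
      qed
      moreover have "\<pi> ` {..<d} \<subseteq> {..<d}" using pm by auto
      ultimately have "\<pi> permutes {..<d}"
        by (intro inj_imp_permutes) (auto simp: \<pi>_def)
      moreover have "f = restrict (g \<circ> \<pi>) {..<d}"
        using pm by (intro extensionalityI[OF ext restrict_extensional]) auto
      ultimately show "f \<in> ?h ` (decreasing_seqs d N \<times> ?P)" using g by force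
    qed
  qed (auto intro!: sum.cong)
  also have "\<dots> = (\<Sum>g\<in>decreasing_seqs d N. \<Sum>\<pi>\<in>?P. ?W (?h (g, \<pi>)))"
    by (simp add: sum.cartesian_product)
  also have "\<dots> = (\<Sum>g\<in>decreasing_seqs d N. fdet d (\<lambda>i j. A i (g j)) * fdet d (\<lambda>i j. B (g i) j))"
  proof (rule sum.cong[OF refl])
    fix g
    have "?W (?h (g, \<pi>)) = of_int (sign \<pi>) * (\<Prod>i<d. A i (g (\<pi> i))) * fdet d (\<lambda>i j. B (g i) j)"
      if "\<pi> \<in> ?P" for \<pi>
    proof -
      have "fdet d (\<lambda>i j. B (?h (g, \<pi>) i) j) = fdet d (\<lambda>i j. B (g (\<pi> i)) j)"
        by (intro fdet_cong) auto
      also have "\<dots> = of_int (sign \<pi>) * fdet d (\<lambda>i j. B (g i) j)"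
        using that by (intro fdet_permute_rows[where f = "\<lambda>i j. B (g i) j"]) auto
      finally show ?thesis by (simp add: mult_ac)
    qed
    then show "(\<Sum>\<pi>\<in>?P. ?W (?h (g, \<pi>))) = fdet d (\<lambda>i j. A i (g j)) * fdet d (\<lambda>i j. B (g i) j)"
      unfolding fdet_expand[of d "\<lambda>i j. A i (g j)"] by (simp add: sum_distrib_right)
  qed
  finally show ?thesis .
qed


section \<open>Giambelli reduction of a determinant with prescribed rows\<close>

text \<open>The sign depends on $d$ alone, hence it is common to $\mu$ and to all the diagrams that occur in
its expansion.\<close>

definition giambelli_sign :: "nat \<Rightarrow> 'a::comm_ring_1" where
  "giambelli_sign d = of_int (sign (\<lambda>i. if i < d then d - 1 - i else i)) * (-1) ^ (\<Sum>j<d. j)"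

lemma reversal_permutes: "(\<lambda>i. if i < d then d - 1 - i else i) permutes {..<d::nat}"
proof (rule inj_imp_permutes)
  show "inj_on (\<lambda>i. if i < d then d - 1 - i else i) {..<d}"
  proof (rule inj_onI)
    fix x y assume "x \<in> {..<d}" "y \<in> {..<d}"
      "(if x < d then d - 1 - x else x) = (if y < d then d - 1 - y else y)"
    then have "d - 1 - x = d - 1 - y" "x < d" "y < d" by simp_all
    then show "x = y" by linarith
  qed
qed simp_all

text \<open>Let the rows below the first $d$ be the unit vectors at the complement of the columns
$q_0 > q_1 > \dots$, in increasing order. Deleting the last row and the column of its unit entry removes
the largest element $c$ of the complement. All columns to the right of $c$ are among the $q_j$, so the sum
of the $q_j$ drops by their number $n - c$, which matches the sign $(-1)^{n + c}$ of the expansion. When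
only $d$ rows are left, the $q_j$ run through all columns in reversed order.\<close>

lemma fdet_unit_rows:
  fixes a :: "nat \<Rightarrow> nat \<Rightarrow> 'a::comm_ring_1"
  assumes "d \<le> n" and "\<And>i j. i < j \<Longrightarrow> j < d \<Longrightarrow> q j < q i" and "\<And>j. j < d \<Longrightarrow> q j < n"
    and "\<And>i j. d \<le> i \<Longrightarrow> i < j \<Longrightarrow> j < n \<Longrightarrow> u i < u j" and "u ` {d..<n} = {..<n} - q ` {..<d}"
  shows "fdet n (\<lambda>i j. if i < d then a i j else if j = u i then 1 else 0) =
    giambelli_sign d * (-1) ^ (\<Sum>j<d. q j) * fdet d (\<lambda>i j. a i (q j))"
  using assms
proof (induction n arbitrary: a q rule: dec_induct)
  case base
  have im: "q ` {..<d} = {..<d}"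
    using base by (intro endo_inj_surj decreasing_inj_on) auto
  have "(\<lambda>j. d - 1 - j) ` {..<d} = (\<lambda>i. if i < d then d - 1 - i else i) ` {..<d}"
    by (intro image_cong) auto
  then have im': "(\<lambda>j. d - 1 - j) ` {..<d} = {..<d}"
    using permutes_image[OF reversal_permutes[of d]] by simp
  have q: "q j = d - 1 - j" if "j < d" for j
    by (rule decreasing_unique[of d q "\<lambda>j. d - 1 - j"]) (use base(1) im im' that in auto)
  let ?r = "\<lambda>i. if i < d then d - 1 - i else i"
  have "fdet d (\<lambda>i j. a i (q j)) = fdet d (\<lambda>i j. a j (?r i))"
    by (subst fdet_transpose[symmetric]) (auto intro!: fdet_cong simp: q)
  also have "\<dots> = of_int (sign ?r) * fdet d (\<lambda>i j. a j i)"
    by (rule fdet_permute_rows[OF reversal_permutes, where f = "\<lambda>i j. a j i"])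
  also have "fdet d (\<lambda>i j. a j i) = fdet d a" by (rule fdet_transpose)
  finally have 1: "fdet d (\<lambda>i j. a i (q j)) = of_int (sign ?r) * fdet d a" .
  have "(\<Sum>j<d. q j) = (\<Sum>x\<in>q ` {..<d}. x)"
    using base by (subst sum.reindex) (auto intro!: decreasing_inj_on)
  then have 2: "(\<Sum>j<d. q j) = (\<Sum>j<d. j)" by (simp add: im)
  have "of_int (sign ?r) * of_int (sign ?r) = (1::'a)"
    unfolding of_int_mult[symmetric] by simp
  moreover have "(-1) ^ (\<Sum>j<d. j) * (-1) ^ (\<Sum>j<d. j) = (1::'a)"
    by (simp flip: power_mult_distrib)
  moreover have "giambelli_sign d * (-1) ^ (\<Sum>j<d. q j) * fdet d (\<lambda>i j. a i (q j)) =
    (of_int (sign ?r) * of_int (sign ?r)) * ((-1) ^ (\<Sum>j<d. j) * (-1) ^ (\<Sum>j<d. j)) * fdet d a"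
    unfolding giambelli_sign_def 1 2 by (simp only: mult_ac)
  ultimately show ?case by (simp add: cong: fdet_cong)
next
  case (step n)
  define c where "c = u n"
  have cim: "c \<in> {..<Suc n} - q ` {..<d}"
    unfolding c_def step(7)[symmetric] using step(1) by (intro imageI) auto
  then have cn: "c \<le> n" and cq: "\<And>j. j < d \<Longrightarrow> q j \<noteq> c" by auto
  have umax: "u i < c" if "d \<le> i" "i < n" for i using step that by (simp add: c_def)
  define q' where "q' = (\<lambda>j. if q j < c then q j else q j - 1)"
  let ?ins = "\<lambda>j. if j < c then j else Suc j"
  have insq: "?ins (q' j) = q j" if "j < d" for j
    using cq[OF that] by (auto simp: q'_def)
  have above: "x \<in> q ` {..<d}" if "c < x" "x \<le> n" for x
  proof (rule ccontr)
    assume "x \<notin> q ` {..<d}"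
    then have "x \<in> u ` {d..<Suc n}" using that step by auto
    then obtain i where "d \<le> i" "i \<le> n" "x = u i" by auto
    then show False using umax[of i] that by (cases "i = n") (auto simp: c_def)
  qed
  have q'im: "u ` {d..<n} = {..<n} - q' ` {..<d}"
  proof (intro equalityI subsetI)
    fix x assume "x \<in> u ` {d..<n}"
    then obtain i where i: "d \<le> i" "i < n" "x = u i" by auto
    have "x \<in> u ` {d..<Suc n}" unfolding i(3) using i by (intro imageI) auto
    then have "x < c" "x \<notin> q ` {..<d}" using umax i unfolding step(7) by auto
    then show "x \<in> {..<n} - q' ` {..<d}" using cn cq by (fastforce simp: q'_def split: if_splits)
  next
    fix x assume x: "x \<in> {..<n} - q' ` {..<d}"
    have "x < c"
    proof (rule ccontr)
      assume "\<not> x < c"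
      then obtain j where "j < d" "Suc x = q j" using above[of "Suc x"] x by auto
      then have "x = q' j" using \<open>\<not> x < c\<close> by (auto simp: q'_def)
      then show False using x \<open>j < d\<close> by auto
    qed
    moreover have "x \<notin> q ` {..<d}" using x \<open>x < c\<close> by (auto simp: q'_def)
    ultimately have "x \<in> u ` {d..<Suc n}" using x unfolding step(7) by auto
    then obtain i where "d \<le> i" "i \<le> n" "x = u i" by auto
    then show "x \<in> u ` {d..<n}" using \<open>x < c\<close> by (cases "i = n") (auto simp: c_def)
  qed
  \<comment> \<open>The columns to the right of \<open>c\<close>, each of which shifts by one, number \<open>n - c\<close>.\<close>
  have parity: "(-1::'a) ^ (n + c) * (-1) ^ (\<Sum>j<d. q' j) = (-1) ^ (\<Sum>j<d. q j)"
  proof -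
    have "(\<Sum>j<d. q j) = (\<Sum>j<d. q' j + (if c < q j then 1 else 0))"
      using cq by (intro sum.cong) (auto simp: q'_def not_less)
    also have "\<dots> = (\<Sum>j<d. q' j) + card {j \<in> {..<d}. c < q j}"
      by (simp add: sum.distrib sum.If_cases Int_def)
    also have "card {j \<in> {..<d}. c < q j} = card (q ` {j \<in> {..<d}. c < q j})"
      using step by (intro card_image[symmetric] inj_on_subset[OF decreasing_inj_on[of d q]]) auto
    also have "q ` {j \<in> {..<d}. c < q j} = {c<..n}"
      using above step(5) by (force simp: less_Suc_eq_le)
    finally have "(\<Sum>j<d. q j) = (\<Sum>j<d. q' j) + (n - c)" by simp
    moreover have "(-1::'a) ^ (n + c) = (-1) ^ (n - c)"
      using cn by (auto simp: minus_one_power_iff)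
    ultimately show ?thesis by (simp add: power_add mult_ac)
  qed
  have "fdet (Suc n) (\<lambda>i j. if i < d then a i j else if j = u i then 1 else 0) =
    (-1) ^ (n + c) * fdet n (\<lambda>i j. if i < d then a i (?ins j) else if ?ins j = u i then 1 else 0)"
    using step(1) cn by (subst fdet_last_row_unit[of c]) (auto simp: c_def)
  also have "fdet n (\<lambda>i j. if i < d then a i (?ins j) else if ?ins j = u i then 1 else 0) =
    fdet n (\<lambda>i j. if i < d then a i (?ins j) else if j = u i then 1 else 0)"
    using umax by (intro fdet_cong) (force simp: not_less)
  also have "\<dots> = giambelli_sign d * (-1) ^ (\<Sum>j<d. q' j) * fdet d (\<lambda>i j. a i (?ins (q' j)))"
  proof (rule step.IH)
    show "q' j < q' i" if "i < j" "j < d" for i j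
      using step(4)[OF that] cq[of i] cq[of j] that by (auto simp: q'_def)
    show "q' j < n" if "j < d" for j
      using step(5)[OF that] cq[OF that] cn by (auto simp: q'_def)
    show "u i < u j" if "d \<le> i" "i < j" "j < n" for i j using step(6) that by auto
  qed (use q'im in auto)
  also have "fdet d (\<lambda>i j. a i (?ins (q' j))) = fdet d (\<lambda>i j. a i (q j))"
    by (intro fdet_cong) (simp add: insq)
  finally show ?case unfolding parity[symmetric] by (simp only: mult_ac)
qed

text \<open>The row labels $k_j$ of a diagram with $d$ diagonal squares and at most $n$ rows have this form: the
first $d$ are nonnegative, and the others are the negatives $-u_j - 1$ where $u$ enumerates the
complement of the $q_j$ in $\{0, \dots, n - 1\}$ in increasing order.\<close>

definition frobenius_rows :: "nat \<Rightarrow> nat \<Rightarrow> (nat \<Rightarrow> int) \<Rightarrow> (nat \<Rightarrow> nat) \<Rightarrow> bool" where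
  "frobenius_rows n d k q \<longleftrightarrow> d \<le> n \<and> (\<forall>i j. i < j \<longrightarrow> j < d \<longrightarrow> q j < q i) \<and> (\<forall>j<d. q j < n) \<and>
     (\<forall>j<d. 0 \<le> k j) \<and>
     (\<exists>u. (\<forall>j. d \<le> j \<longrightarrow> j < n \<longrightarrow> k j = - int (u j) - 1) \<and>
          (\<forall>i j. d \<le> i \<longrightarrow> i < j \<longrightarrow> j < n \<longrightarrow> u i < u j) \<and>
          u ` {d..<n} = {..<n} - q ` {..<d})"

text \<open>Giambelli's formula in terms of rows: multiplication by the inverse of the block of rows with
labels $-1, \dots, -n$ turns these rows into unit vectors.\<close>

lemma giambelli_rows:
  fixes X :: "int \<Rightarrow> nat \<Rightarrow> 'a::comm_ring_1"
  assumes inverse: "\<And>q c. q < n \<Longrightarrow> c < n \<Longrightarrow> (\<Sum>i<n. X (- int q - 1) i * W i c) = (if c = q then 1 else 0)"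
    and det_W: "fdet n W = 1" and rows: "frobenius_rows n d k q"
  shows "fdet n (\<lambda>j. X (k j)) = giambelli_sign d * (-1) ^ (\<Sum>j<d. q j) *
    fdet d (\<lambda>i j. \<Sum>c<n. X (k i) c * W c (q j))"
proof -
  from rows obtain u where u: "\<And>j. d \<le> j \<Longrightarrow> j < n \<Longrightarrow> k j = - int (u j) - 1"
      "\<And>i j. d \<le> i \<Longrightarrow> i < j \<Longrightarrow> j < n \<Longrightarrow> u i < u j" "u ` {d..<n} = {..<n} - q ` {..<d}"
    and dn: "d \<le> n" and q: "\<And>i j. i < j \<Longrightarrow> j < d \<Longrightarrow> q j < q i" "\<And>j. j < d \<Longrightarrow> q j < n"
    unfolding frobenius_rows_def by blast
  have un: "u j < n" if "d \<le> j" "j < n" for j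
    using imageI[of j "{d..<n}" u] that u(3) by auto
  have "fdet n (\<lambda>j. X (k j)) = fdet n (\<lambda>j. X (k j)) * fdet n W" by (simp add: det_W)
  also have "\<dots> = fdet n (\<lambda>i j. if i < d then \<Sum>c<n. X (k i) c * W c j else if j = u i then 1 else 0)"
    unfolding fdet_mult by (intro fdet_cong) (auto simp: u(1) inverse un not_less)
  also have "\<dots> = giambelli_sign d * (-1) ^ (\<Sum>j<d. q j) * fdet d (\<lambda>i j. \<Sum>c<n. X (k i) c * W c (q j))"
    by (rule fdet_unit_rows[where a = "\<lambda>i j. \<Sum>c<n. X (k i) c * W c j", OF dn q u(2,3)])
  finally show ?thesis .
qed

lemma sum_reassociate:
  fixes a :: "nat \<Rightarrow> 'a::comm_ring_1"
  shows "(\<Sum>i<n. a i * (\<Sum>j<m. b i j * c j)) = (\<Sum>j<m. (\<Sum>i<n. a i * b i j) * c j)"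
  unfolding sum_distrib_left sum_distrib_right mult.assoc by (rule sum.swap)

text \<open>The rows of \<open>Y\<close> arise from those of \<open>X\<close> by a transition matrix with diagonal blocks
\<open>C\<close> and \<open>T\<close>. If \<open>W\<close> inverts the negative rows of \<open>X\<close> and \<open>D\<close> inverts \<open>T\<close>, then \<open>W D\<close>
inverts the negative rows of \<open>Y\<close>, so the matrix of \<open>Y\<close> in \<open>giambelli_rows\<close> is \<open>C A D\<close> with \<open>A\<close> the
corresponding matrix of \<open>X\<close>. Its minors expand by applying Cauchy--Binet twice.\<close>

lemma block_change_of_rows:
  fixes X Y :: "int \<Rightarrow> nat \<Rightarrow> 'a::comm_ring_1"
  assumes nonneg: "\<And>p i. p < N \<Longrightarrow> i < n \<Longrightarrow> Y (int p) i = (\<Sum>p'<N. C p p' * X (int p') i)"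
    and neg: "\<And>q i. q < n \<Longrightarrow> i < n \<Longrightarrow> Y (- int q - 1) i = (\<Sum>r<n. T q r * X (- int r - 1) i)"
    and TD: "\<And>q c. q < n \<Longrightarrow> c < n \<Longrightarrow> (\<Sum>r<n. T q r * D r c) = (if c = q then 1 else 0)"
    and det_D: "fdet n D = 1"
    and inverse: "\<And>q c. q < n \<Longrightarrow> c < n \<Longrightarrow> (\<Sum>i<n. X (- int q - 1) i * W i c) = (if c = q then 1 else 0)"
    and det_W: "fdet n W = 1"
    and rows: "frobenius_rows n d k q" and kN: "\<And>i. i < d \<Longrightarrow> k i < int N"
  shows "fdet n (\<lambda>j. Y (k j)) =
    (\<Sum>P\<in>decreasing_seqs d N. \<Sum>Q\<in>decreasing_seqs d n.
       fdet d (\<lambda>i j. C (nat (k i)) (P j)) * fdet d (\<lambda>i j. D (Q i) (q j)) *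
       (giambelli_sign d * (-1) ^ (\<Sum>j<d. q j) * fdet d (\<lambda>i j. \<Sum>c<n. X (int (P i)) c * W c (Q j))))"
proof -
  \<comment> \<open>The inverse of the negative rows of \<open>Y\<close>.\<close>
  define W' where "W' = (\<lambda>i c. \<Sum>r<n. W i r * D r c)"
  have det_W': "fdet n W' = 1"
    using fdet_mult[of n W D] by (simp add: W'_def det_W det_D)
  have inverse': "(\<Sum>i<n. Y (- int q - 1) i * W' i c) = (if c = q then 1 else 0)" if "q < n" "c < n" for q c
  proof -
    have "(\<Sum>i<n. Y (- int q - 1) i * W' i c) = (\<Sum>i<n. (\<Sum>r<n. T q r * X (- int r - 1) i) * W' i c)"
      using that by (simp add: neg)
    also have "\<dots> = (\<Sum>r'<n. (\<Sum>i<n. (\<Sum>r<n. T q r * X (- int r - 1) i) * W i r') * D r' c)"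
      unfolding W'_def by (rule sum_reassociate)
    also have "\<dots> = (\<Sum>r'<n. (\<Sum>r<n. T q r * (\<Sum>i<n. X (- int r - 1) i * W i r')) * D r' c)"
      unfolding sum_reassociate ..
    also have "\<dots> = (\<Sum>r'<n. (\<Sum>r<n. T q r * (if r' = r then 1 else 0)) * D r' c)"
      using inverse by (intro sum.cong refl arg_cong2[of _ _ _ _ "(*)"]) auto
    also have "\<dots> = (\<Sum>r'<n. T q r' * D r' c)"
      by (intro sum.cong refl) (simp add: if_distrib[of "(*) _"] cong: if_cong)
    finally show ?thesis using TD that by simp
  qed
  have k_nonneg: "0 \<le> k i" if "i < d" for i
    using rows that by (auto simp: frobenius_rows_def)
  let ?A = "\<lambda>p r. \<Sum>c<n. X (int p) c * W c r"
  have entry: "(\<Sum>c<n. Y (k i) c * W' c (q j)) = (\<Sum>p'<N. C (nat (k i)) p' * (\<Sum>r<n. ?A p' r * D r (q j)))"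
    if "i < d" for i j
  proof -
    have "Y (k i) c = (\<Sum>p'<N. C (nat (k i)) p' * X (int p') c)" if "c < n" for c
      using nonneg[of "nat (k i)" c] k_nonneg[OF \<open>i < d\<close>] kN[OF \<open>i < d\<close>] that by simp
    then have "(\<Sum>c<n. Y (k i) c * W' c (q j)) = (\<Sum>c<n. (\<Sum>p'<N. C (nat (k i)) p' * X (int p') c) * W' c (q j))"
      by simp
    also have "\<dots> = (\<Sum>p'<N. C (nat (k i)) p' * (\<Sum>c<n. X (int p') c * W' c (q j)))"
      by (rule sum_reassociate[symmetric])
    finally show ?thesis by (simp add: W'_def sum_reassociate)
  qed
  have "fdet n (\<lambda>j. Y (k j)) = giambelli_sign d * (-1) ^ (\<Sum>j<d. q j) *
      fdet d (\<lambda>i j. \<Sum>p'<N. C (nat (k i)) p' * (\<Sum>r<n. ?A p' r * D r (q j)))"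
  proof -
    have "fdet n (\<lambda>j. Y (k j)) = giambelli_sign d * (-1) ^ (\<Sum>j<d. q j) *
        fdet d (\<lambda>i j. \<Sum>c<n. Y (k i) c * W' c (q j))"
      by (rule giambelli_rows[OF _ det_W' rows]) (rule inverse')
    also have "fdet d (\<lambda>i j. \<Sum>c<n. Y (k i) c * W' c (q j)) =
        fdet d (\<lambda>i j. \<Sum>p'<N. C (nat (k i)) p' * (\<Sum>r<n. ?A p' r * D r (q j)))"
      by (rule fdet_cong) (rule entry)
    finally show ?thesis .
  qed
  also have "fdet d (\<lambda>i j. \<Sum>p'<N. C (nat (k i)) p' * (\<Sum>r<n. ?A p' r * D r (q j))) =
      (\<Sum>P\<in>decreasing_seqs d N. fdet d (\<lambda>i j. C (nat (k i)) (P j)) *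
        (\<Sum>Q\<in>decreasing_seqs d n. fdet d (\<lambda>i j. ?A (P i) (Q j)) * fdet d (\<lambda>i j. D (Q i) (q j))))"
    unfolding cauchy_binet[where B = "\<lambda>p' j. \<Sum>r<n. ?A p' r * D r (q j)"]
      cauchy_binet[where B = "\<lambda>r j. D r (q j)"] ..
  finally show ?thesis by (simp add: sum_distrib_left mult_ac)
qed


section \<open>Frobenius coordinates of Young diagrams\<close>

lemma initial_interval:
  fixes S :: "nat set"
  assumes "finite S" "\<And>x. x \<in> S \<Longrightarrow> 1 \<le> x" "\<And>x y. x \<in> S \<Longrightarrow> 1 \<le> y \<Longrightarrow> y \<le> x \<Longrightarrow> y \<in> S"
  shows "S = {1..card S}"
proof (cases "S = {}")
  case False
  have S: "S = {1..Max S}"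
  proof (intro equalityI subsetI)
    show "x \<in> {1..Max S}" if "x \<in> S" for x using assms(2)[OF that] Max_ge[OF assms(1) that] by simp
    show "x \<in> S" if "x \<in> {1..Max S}" for x using assms(3)[OF Max_in[OF assms(1) False]] that by simp
  qed
  have "card S = Max S" using arg_cong[OF S, of card] by simp
  with S show ?thesis by simp
qed simp

lemma row_antitone:
  assumes "young \<mu>" "1 \<le> i" "i \<le> j"
  shows "row \<mu> j \<le> row \<mu> i"
proof (cases "i = j \<or> length \<mu> < j")
  case True
  then show ?thesis by (auto simp: row_def)
next
  case False
  have "\<mu> ! (j - 1) \<le> \<mu> ! (i - 1)"
  proof -
    have "i - 1 < j - 1" "j - 1 < length \<mu>" using False assms(2,3) by arith+
    then show ?thesis using assms(1) unfolding young_def sorted_wrt_iff_nth_less by blast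
  qed
  then show ?thesis using assms False by (simp add: row_def)
qed

lemma row_pos_iff: "young \<mu> \<Longrightarrow> 0 < row \<mu> i \<longleftrightarrow> 1 \<le> i \<and> i \<le> length \<mu>"
proof (cases "1 \<le> i \<and> i \<le> length \<mu>")
  case True
  then have "\<mu> ! (i - 1) \<in> set \<mu>" by (intro nth_mem) arith
  moreover assume "young \<mu>"
  ultimately have "\<mu> ! (i - 1) \<noteq> 0" unfolding young_def by metis
  then show ?thesis using True by (simp add: row_def)
qed (auto simp: row_def)

text \<open>Both sides say that the square in row $i$ and column $j$ belongs to the diagram.\<close>

lemma le_row_iff:
  assumes "young \<mu>" "1 \<le> i" "1 \<le> j"
  shows "j \<le> row \<mu> i \<longleftrightarrow> i \<le> column \<mu> j"
proof -
  let ?S = "{i \<in> {1..length \<mu>}. j \<le> row \<mu> i}"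
  have "?S = {1..column \<mu> j}"
    unfolding column_def
  proof (rule initial_interval)
    show "y \<in> ?S" if "x \<in> ?S" "1 \<le> y" "y \<le> x" for x y
      using that row_antitone[OF assms(1) that(2,3)] by auto
  qed auto
  moreover have "i \<in> ?S \<longleftrightarrow> j \<le> row \<mu> i"
    using row_pos_iff[OF assms(1), of i] assms by auto
  ultimately show ?thesis using assms by auto
qed

lemma le_diag_iff:
  assumes "young \<mu>" "1 \<le> i"
  shows "i \<le> row \<mu> i \<longleftrightarrow> i \<le> diag_squares \<mu>"
proof -
  let ?S = "{i \<in> {1..length \<mu>}. i \<le> row \<mu> i}"
  have "?S = {1..diag_squares \<mu>}"
    unfolding diag_squares_def
  proof (rule initial_interval)
    show "y \<in> ?S" if "x \<in> ?S" "1 \<le> y" "y \<le> x" for x y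
      using that row_antitone[OF assms(1) that(2,3)] by auto
  qed auto
  moreover have "i \<in> ?S \<longleftrightarrow> i \<le> row \<mu> i"
    using row_pos_iff[OF assms(1), of i] assms by auto
  ultimately show ?thesis using assms by auto
qed

lemma column_le_length: "column \<mu> j \<le> length \<mu>"
  unfolding column_def by (rule order_trans[OF card_mono[of "{1..length \<mu>}"]]) auto

lemma diag_le_length: "diag_squares \<mu> \<le> length \<mu>"
  unfolding diag_squares_def by (rule order_trans[OF card_mono[of "{1..length \<mu>}"]]) auto

lemma column_antitone: "i \<le> j \<Longrightarrow> column \<mu> j \<le> column \<mu> i"
  unfolding column_def by (intro card_mono) auto

lemma diag_le_row:
  assumes "young \<mu>" "1 \<le> i" "i \<le> diag_squares \<mu>"
  shows "diag_squares \<mu> \<le> row \<mu> i"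
  using row_antitone[OF assms(1,2,3)] le_diag_iff[OF assms(1), of "diag_squares \<mu>"] assms by auto

lemma diag_le_column:
  assumes "young \<mu>" "1 \<le> j" "j \<le> diag_squares \<mu>"
  shows "diag_squares \<mu> \<le> column \<mu> j"
  using le_row_iff[OF assms(1), of "diag_squares \<mu>" j] diag_le_row[OF assms(1), of "diag_squares \<mu>"] assms by auto

lemma row_le_beyond_diag:
  assumes "young \<mu>" "diag_squares \<mu> < i"
  shows "row \<mu> i \<le> diag_squares \<mu>"
  using row_antitone[OF assms(1), of "Suc (diag_squares \<mu>)" i] le_diag_iff[OF assms(1), of "Suc (diag_squares \<mu>)"] assms by auto

text \<open>The negative labels $\mu_j - j$ and the numbers $-q_i - 1 = i - 1 - \mu'_i$ are disjoint: the
square in row $j$ and column $i$ either belongs to the diagram, and then $\mu_j + \mu'_i \ge i + j$, or does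
not, and then $\mu_j + \mu'_i \le i + j - 2$. By counting they exhaust $-1, \dots, -n$.\<close>

lemma frobenius_rows_young:
  assumes \<mu>: "young \<mu>" and n: "length \<mu> \<le> n"
  shows "frobenius_rows n (diag_squares \<mu>) (\<lambda>j. int (row \<mu> (j + 1)) - int (j + 1)) (\<lambda>j. frob_q \<mu> (j + 1))"
proof -
  let ?d = "diag_squares \<mu>" and ?q = "\<lambda>j. frob_q \<mu> (j + 1)" and ?u = "\<lambda>j. j - row \<mu> (j + 1)"
  have dn: "?d \<le> n" using diag_le_length[of \<mu>] n by simp
  have q: "?q j < ?q i" if "i < j" "j < ?d" for i j
    using column_antitone[of "i + 1" "j + 1" \<mu>] diag_le_column[OF \<mu>, of "j + 1"] that
    by (auto simp: frob_q_def)
  have qn: "?q j < n" if "j < ?d" for j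
    using column_le_length[of \<mu> "j + 1"] n diag_le_column[OF \<mu>, of "j + 1"] that by (auto simp: frob_q_def)
  have row_le: "row \<mu> (j + 1) \<le> j" if "?d \<le> j" for j
    using row_le_beyond_diag[OF \<mu>, of "j + 1"] that by auto
  have u: "?u i < ?u j" if "?d \<le> i" "i < j" for i j
    using row_antitone[OF \<mu>, of "i + 1" "j + 1"] row_le[of i] row_le[of j] that by auto
  have "?u ` {?d..<n} = {..<n} - ?q ` {..<?d}"
  proof (rule card_subset_eq)
    show "?u ` {?d..<n} \<subseteq> {..<n} - ?q ` {..<?d}"
    proof
      fix x assume "x \<in> ?u ` {?d..<n}"
      then obtain j where x: "x = ?u j" and j: "?d \<le> j" "j < n" by auto
      have "?u j \<noteq> ?q i" if i: "i < ?d" for i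
      proof
        assume eq: "?u j = ?q i"
        have "j + (i + 1) = column \<mu> (i + 1) + row \<mu> (j + 1)"
          using eq row_le[OF j(1)] diag_le_column[OF \<mu>, of "i + 1"] i by (auto simp: frob_q_def)
        then show False using le_row_iff[OF \<mu>, of "j + 1" "i + 1"] by linarith
      qed
      then have "x \<notin> ?q ` {..<?d}" unfolding x by blast
      moreover have "x < n" unfolding x using j by arith
      ultimately show "x \<in> {..<n} - ?q ` {..<?d}" by blast
    qed
    have "inj_on ?u {?d..<n}"
    proof (rule inj_onI)
      fix x y assume "x \<in> {?d..<n}" "y \<in> {?d..<n}" "?u x = ?u y"
      then show "x = y" using u[of x y] u[of y x] by (cases x y rule: linorder_cases) auto
    qed
    then have "card (?u ` {?d..<n}) = n - ?d" by (simp add: card_image)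
    moreover have "card ({..<n} - ?q ` {..<?d}) = n - ?d"
    proof -
      have "card (?q ` {..<?d}) = ?d" using card_image[OF decreasing_inj_on[of ?d ?q]] q by simp
      then show ?thesis using qn by (subst card_Diff_subset) auto
    qed
    ultimately show "card (?u ` {?d..<n}) = card ({..<n} - ?q ` {..<?d})" by simp
  qed simp
  then have "\<exists>u. (\<forall>j. ?d \<le> j \<longrightarrow> j < n \<longrightarrow> int (row \<mu> (j + 1)) - int (j + 1) = - int (u j) - 1) \<and>
      (\<forall>i j. ?d \<le> i \<longrightarrow> i < j \<longrightarrow> j < n \<longrightarrow> u i < u j) \<and> u ` {?d..<n} = {..<n} - ?q ` {..<?d}"
  proof (intro exI[of _ ?u] conjI allI impI)
    show "int (row \<mu> (j + 1)) - int (j + 1) = - int (?u j) - 1" if "?d \<le> j" for j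
      using row_le[OF that] by linarith
  qed (rule u)
  moreover have "0 \<le> int (row \<mu> (j + 1)) - int (j + 1)" if "j < ?d" for j
    using diag_le_row[OF \<mu>, of "j + 1"] that by linarith
  ultimately show ?thesis unfolding frobenius_rows_def using dn q qn by blast
qed

text \<open>The first $d$ rows are compared through the $p_i$. A row below the diagonal has length at most
$d$, so its last square lies in one of the first $d$ columns, which are compared through the $q_i$.\<close>

lemma contained_of_frobenius:
  assumes \<mu>: "young \<mu>" and \<nu>: "young \<nu>" and d: "diag_squares \<nu> = diag_squares \<mu>"
    and p: "\<And>i. i < diag_squares \<mu> \<Longrightarrow> frob_p \<nu> (i + 1) \<le> frob_p \<mu> (i + 1)"
    and q: "\<And>i. i < diag_squares \<mu> \<Longrightarrow> frob_q \<nu> (i + 1) \<le> frob_q \<mu> (i + 1)"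
  shows "contained \<nu> \<mu>"
  unfolding contained_def
proof
  fix i
  consider "row \<nu> i = 0" | "1 \<le> i" "i \<le> diag_squares \<mu>" | "1 \<le> row \<nu> i" "diag_squares \<mu> < i"
  proof -
    have "i = 0 \<Longrightarrow> row \<nu> i = 0" by (simp add: row_def)
    then have "row \<nu> i = 0 \<or> (1 \<le> i \<and> i \<le> diag_squares \<mu>) \<or> (1 \<le> row \<nu> i \<and> diag_squares \<mu> < i)"
      by (cases "i = 0"; cases "row \<nu> i = 0") auto
    then show ?thesis using that by blast
  qed
  then show "row \<nu> i \<le> row \<mu> i"
  proof cases
    case 2
    then have "i - 1 < diag_squares \<mu>" "i - 1 + 1 = i" by arith+
    with p[of "i - 1"] have "row \<nu> i - i \<le> row \<mu> i - i" by (simp only: frob_p_def)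
    then show ?thesis using diag_le_row[OF \<mu>, of i] diag_le_row[OF \<nu>, of i] d 2 by simp
  next
    case 3
    let ?j = "row \<nu> i"
    have j: "?j \<le> diag_squares \<mu>" using row_le_beyond_diag[OF \<nu>] 3 d by simp
    have "i \<le> column \<nu> ?j" using le_row_iff[OF \<nu>, of i ?j] 3 by simp
    also have "\<dots> \<le> column \<mu> ?j"
    proof -
      have "?j - 1 < diag_squares \<mu>" "?j - 1 + 1 = ?j" using j 3 by arith+
      with q[of "?j - 1"] have "column \<nu> ?j - ?j \<le> column \<mu> ?j - ?j" by (simp only: frob_q_def)
      then show ?thesis using diag_le_column[OF \<mu>, of ?j] diag_le_column[OF \<nu>, of ?j] d j 3 by simp
    qed
    finally show ?thesis using le_row_iff[OF \<mu>, of i ?j] 3 by simp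
  qed simp
qed

lemma length_le_of_contained:
  assumes "young \<nu>" "contained \<nu> \<mu>"
  shows "length \<nu> \<le> length \<mu>"
proof (cases "length \<nu> = 0")
  case False
  then have "0 < row \<nu> (length \<nu>)" using row_pos_iff[OF assms(1)] by (simp add: Suc_le_eq)
  also have "row \<nu> (length \<nu>) \<le> row \<mu> (length \<nu>)" using assms(2) by (simp add: contained_def)
  finally show ?thesis by (simp add: row_def split: if_splits)
qed simp

lemma young_eqI:
  assumes \<mu>: "young \<mu>" and \<nu>: "young \<nu>" and "contained \<nu> \<mu>" "contained \<mu> \<nu>"
  shows "\<nu> = \<mu>"
proof -
  have r: "row \<nu> i = row \<mu> i" for i using assms by (auto simp: contained_def intro: antisym)
  have "length \<kappa> \<le> length \<kappa>'" if "young \<kappa>" "young \<kappa>'" "\<And>i. row \<kappa> i = row \<kappa>' i" for \<kappa> \<kappa>'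
    using row_pos_iff[OF that(1), of "length \<kappa>"] row_pos_iff[OF that(2), of "length \<kappa>"] that(3)[of "length \<kappa>"]
    by (cases "1 \<le> length \<kappa>") simp_all
  from this[OF \<mu> \<nu>] this[OF \<nu> \<mu>] have l: "length \<nu> = length \<mu>" by (simp add: r)
  show ?thesis
  proof (rule nth_equalityI[OF l])
    show "\<nu> ! i = \<mu> ! i" if "i < length \<nu>" for i using r[of "Suc i"] that l by (simp add: row_def)
  qed
qed

lemma decreasing_seqs_gap:
  assumes "f \<in> decreasing_seqs d N" "i \<le> j" "j < d"
  shows "f j + j \<le> f i + i"
  using assms(2,3)
proof (induction j rule: dec_induct)
  case (step j)
  then show ?case using decreasing_seqs_D(1)[OF assms(1), of j "Suc j"] by simp
qed simp

lemma decreasing_seqs_lower: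
  assumes "f \<in> decreasing_seqs d N" "i < d"
  shows "d \<le> f i + i + 1"
proof -
  have "i \<le> d - 1" "d - 1 < d" using assms(2) by arith+
  from decreasing_seqs_gap[OF assms(1) this] show ?thesis by arith
qed

text \<open>The first $d$ rows of the diagram are prescribed by $P$. A later row $i$ meets exactly those of the
first $d$ columns whose prescribed length is at least $i$, and these form an initial segment because
$Q_j + j$ decreases weakly.\<close>

lemma young_of_frobenius:
  assumes P: "P \<in> decreasing_seqs d N" and Q: "Q \<in> decreasing_seqs d n"
  obtains \<nu> where "young \<nu>" "length \<nu> \<le> n" "diag_squares \<nu> = d"
    "\<And>i. i < d \<Longrightarrow> frob_p \<nu> (i + 1) = P i" "\<And>i. i < d \<Longrightarrow> frob_q \<nu> (i + 1) = Q i"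
proof -
  \<comment> \<open>The columns among the first \<open>d\<close> that reach row \<open>i\<close>.\<close>
  define leg where "leg = (\<lambda>i. {j \<in> {1..d}. i \<le> Q (j - 1) + j})"
  define r where "r = (\<lambda>i. if i \<le> d then P (i - 1) + i else card (leg i))"
  have leg: "leg i = {1..card (leg i)}" for i
  proof (rule initial_interval)
    show "y \<in> leg i" if "x \<in> leg i" "1 \<le> y" "y \<le> x" for x y
    proof -
      have x: "1 \<le> x" "x \<le> d" "i \<le> Q (x - 1) + x" using that(1) by (auto simp: leg_def)
      then have "y - 1 \<le> x - 1" "x - 1 < d" using that by arith+
      from decreasing_seqs_gap[OF Q this] have "i \<le> Q (y - 1) + y" using x that by arith
      then show ?thesis using x that by (simp add: leg_def)
    qed
  qed (auto simp: leg_def)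
  have leg_d: "card (leg i) \<le> d" for i
    unfolding leg_def by (rule order_trans[OF card_mono[of "{1..d}"]]) auto
  have Qn: "Q j + j < n" if "j < d" for j
    using decreasing_seqs_gap[OF Q, of 0 j] decreasing_seqs_D(2)[OF Q, of 0] that by simp
  have dn: "d \<le> n" using Qn[of "d - 1"] by (cases d) auto
  have r_ge: "d \<le> r i" if "1 \<le> i" "i \<le> d" for i
  proof -
    have "i - 1 < d" using that by arith
    from decreasing_seqs_lower[OF P this] show ?thesis using that by (simp add: r_def)
  qed
  have r_zero: "r i = 0" if "n < i" for i
  proof -
    have "\<not> i \<le> Q (j - 1) + j" if "j \<in> {1..d}" for j
    proof -
      have "j - 1 < d" "1 \<le> j" using that by auto
      with Qn[of "j - 1"] \<open>n < i\<close> show ?thesis by arith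
    qed
    then have "leg i = {}" unfolding leg_def by blast
    then show ?thesis using that dn by (simp add: r_def)
  qed
  have r_anti: "r j \<le> r i" if "1 \<le> i" "i \<le> j" for i j
  proof -
    consider "j \<le> d" | "i \<le> d" "d < j" | "d < i" using that by linarith
    then show ?thesis
    proof cases
      case 1
      then have "i - 1 \<le> j - 1" "j - 1 < d" using that by arith+
      from decreasing_seqs_gap[OF P this] have "P (j - 1) + j \<le> P (i - 1) + i" using that by arith
      then show ?thesis using that 1 by (simp add: r_def)
    next
      case 2 then show ?thesis using that r_ge[of i] leg_d[of j] by (simp add: r_def)
    next
      case 3 then show ?thesis using that by (auto simp: r_def leg_def intro!: card_mono)
    qed
  qed
  define m where "m = card {i \<in> {1..n}. 0 < r i}"
  have pos: "{i \<in> {1..n}. 0 < r i} = {1..m}"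
    unfolding m_def
  proof (rule initial_interval)
    show "y \<in> {i \<in> {1..n}. 0 < r i}" if "x \<in> {i \<in> {1..n}. 0 < r i}" "1 \<le> y" "y \<le> x" for x y
      using that r_anti[of y x] by auto
  qed auto
  have pos_iff: "0 < r i \<longleftrightarrow> i \<le> m" if "1 \<le> i" for i
  proof -
    have "0 < r i \<longleftrightarrow> i \<in> {i \<in> {1..n}. 0 < r i}" using that r_zero[of i] by (cases "n < i") auto
    then show ?thesis unfolding pos using that by auto
  qed
  define \<nu> where "\<nu> = map (\<lambda>i. r (Suc i)) [0..<m]"
  have len: "length \<nu> = m" by (simp add: \<nu>_def)
  have row: "row \<nu> i = r i" if "1 \<le> i" for i
    using pos_iff[OF that] that by (auto simp: row_def \<nu>_def)
  have young: "young \<nu>"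
    unfolding young_def sorted_wrt_iff_nth_less
  proof (intro conjI allI impI)
    show "\<nu> ! j \<le> \<nu> ! i" if "i < j" "j < length \<nu>" for i j
      using r_anti[of "Suc i" "Suc j"] that by (simp add: \<nu>_def)
    show "0 \<notin> set \<nu>"
    proof
      assume "0 \<in> set \<nu>"
      then obtain i where "i < m" "r (Suc i) = 0" by (auto simp: \<nu>_def)
      with pos_iff[of "Suc i"] show False by simp
    qed
  qed
  moreover have len_n: "length \<nu> \<le> n"
    unfolding len m_def by (rule order_trans[OF card_mono[of "{1..n}"]]) auto
  moreover have "diag_squares \<nu> = d"
  proof -
    have "{i \<in> {1..length \<nu>}. i \<le> row \<nu> i} = {1..d}"
    proof (intro equalityI subsetI)
      fix i assume "i \<in> {1..d}"
      then show "i \<in> {i \<in> {1..length \<nu>}. i \<le> row \<nu> i}"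
        using r_ge[of i] row[of i] pos_iff[of i] by (auto simp: len)
    next
      fix i assume "i \<in> {i \<in> {1..length \<nu>}. i \<le> row \<nu> i}"
      then show "i \<in> {1..d}" using row[of i] leg_d[of i] by (auto simp: r_def split: if_splits)
    qed
    then show ?thesis by (simp add: diag_squares_def)
  qed
  moreover have "frob_p \<nu> (i + 1) = P i" if "i < d" for i
    using row[of "i + 1"] that by (simp add: frob_p_def r_def)
  moreover have "frob_q \<nu> (i + 1) = Q i" if "i < d" for i
  proof -
    have "i + 1 \<le> row \<nu> x \<longleftrightarrow> x \<le> Q i + (i + 1)" if x: "1 \<le> x" for x
    proof (cases "x \<le> d")
      case True
      then show ?thesis
        using r_ge[OF x True] row[OF x] decreasing_seqs_lower[OF Q \<open>i < d\<close>] \<open>i < d\<close> by auto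
    next
      case False
      have "i + 1 \<le> card (leg x) \<longleftrightarrow> i + 1 \<in> leg x" by (subst leg) auto
      then show ?thesis using False row[OF x] \<open>i < d\<close> by (auto simp: r_def leg_def)
    qed
    then have "{x \<in> {1..length \<nu>}. i + 1 \<le> row \<nu> x} = {1..Q i + (i + 1)}"
      using row_pos_iff[OF young] by (auto simp: Suc_le_eq) (metis gr0I not_less_zero Suc_le_eq)
    then show ?thesis by (simp add: frob_q_def column_def)
  qed
  ultimately show ?thesis using that by blast
qed

lemma frob_p_decreasing:
  assumes "young \<mu>" "i < j" "j < diag_squares \<mu>"
  shows "frob_p \<mu> (j + 1) < frob_p \<mu> (i + 1)"
  using row_antitone[OF assms(1), of "i + 1" "j + 1"] diag_le_row[OF assms(1), of "j + 1"] assms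
  by (simp add: frob_p_def)

lemma frob_q_decreasing:
  assumes "young \<mu>" "i < j" "j < diag_squares \<mu>"
  shows "frob_q \<mu> (j + 1) < frob_q \<mu> (i + 1)"
  using frobenius_rows_young[OF assms(1) le_refl] assms(2,3) unfolding frobenius_rows_def by blast

lemma frob_q_less:
  assumes "young \<mu>" "length \<mu> \<le> n" "j < diag_squares \<mu>"
  shows "frob_q \<mu> (j + 1) < n"
  using frobenius_rows_young[OF assms(1,2)] assms(3) unfolding frobenius_rows_def by blast

definition frob_p_seq :: "nat list \<Rightarrow> nat \<Rightarrow> nat" where
  "frob_p_seq \<nu> = restrict (\<lambda>i. frob_p \<nu> (i + 1)) {..<diag_squares \<nu>}"

definition frob_q_seq :: "nat list \<Rightarrow> nat \<Rightarrow> nat" where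
  "frob_q_seq \<nu> = restrict (\<lambda>i. frob_q \<nu> (i + 1)) {..<diag_squares \<nu>}"

text \<open>Injectivity is \<open>contained_of_frobenius\<close> in both directions. The bounds $N$ and $n$ make both sides
finite.\<close>

lemma frobenius_bijection:
  "bij_betw (\<lambda>\<nu>. (frob_p_seq \<nu>, frob_q_seq \<nu>))
     {\<nu>. young \<nu> \<and> length \<nu> \<le> n \<and> diag_squares \<nu> = d \<and> (\<forall>i<d. frob_p \<nu> (i + 1) < N)}
     (decreasing_seqs d N \<times> decreasing_seqs d n)"
  (is "bij_betw ?f ?V _")
  unfolding bij_betw_def
proof (intro conjI equalityI subsetI)
  show "inj_on ?f ?V"
  proof (rule inj_onI)
    fix \<mu> \<nu> assume \<mu>: "\<mu> \<in> ?V" and \<nu>: "\<nu> \<in> ?V" and eq: "?f \<mu> = ?f \<nu>"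
    have p: "frob_p \<mu> (i + 1) = frob_p \<nu> (i + 1)" and q: "frob_q \<mu> (i + 1) = frob_q \<nu> (i + 1)" if "i < d" for i
    proof -
      have "frob_p_seq \<mu> i = frob_p_seq \<nu> i" "frob_q_seq \<mu> i = frob_q_seq \<nu> i" using eq by simp_all
      then show "frob_p \<mu> (i + 1) = frob_p \<nu> (i + 1)" "frob_q \<mu> (i + 1) = frob_q \<nu> (i + 1)"
        using \<mu> \<nu> that by (simp_all add: frob_p_seq_def frob_q_seq_def)
    qed
    have y: "young \<mu>" "young \<nu>" and d: "diag_squares \<mu> = d" "diag_squares \<nu> = d" using \<mu> \<nu> by auto
    show "\<mu> = \<nu>"
      by (rule young_eqI[OF y(2,1)]; rule contained_of_frobenius; simp only: y d p q)
  qed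
next
  fix x assume "x \<in> ?f ` ?V"
  then obtain \<nu> where \<nu>: "\<nu> \<in> ?V" and x: "x = ?f \<nu>" by blast
  then have y: "young \<nu>" and d: "diag_squares \<nu> = d" and l: "length \<nu> \<le> n" and p: "\<And>i. i < d \<Longrightarrow> frob_p \<nu> (i + 1) < N" by auto
  have "frob_p_seq \<nu> \<in> decreasing_seqs d N"
    unfolding decreasing_seqs_def
  proof (intro CollectI conjI allI impI PiE_I)
    show "frob_p_seq \<nu> i \<in> {..<N}" if "i \<in> {..<d}" for i using p that by (simp add: frob_p_seq_def d)
    show "frob_p_seq \<nu> i = undefined" if "i \<notin> {..<d}" for i using that by (simp add: frob_p_seq_def d)
    show "frob_p_seq \<nu> j < frob_p_seq \<nu> i" if "i < j" "j < d" for i j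
      using frob_p_decreasing[OF y, of i j] that by (simp add: frob_p_seq_def d)
  qed
  moreover have "frob_q_seq \<nu> \<in> decreasing_seqs d n"
    unfolding decreasing_seqs_def
  proof (intro CollectI conjI allI impI PiE_I)
    show "frob_q_seq \<nu> i \<in> {..<n}" if "i \<in> {..<d}" for i using frob_q_less[OF y l, of i] that by (simp add: frob_q_seq_def d)
    show "frob_q_seq \<nu> i = undefined" if "i \<notin> {..<d}" for i using that by (simp add: frob_q_seq_def d)
    show "frob_q_seq \<nu> j < frob_q_seq \<nu> i" if "i < j" "j < d" for i j
      using frob_q_decreasing[OF y, of i j] that by (simp add: frob_q_seq_def d)
  qed
  ultimately show "x \<in> decreasing_seqs d N \<times> decreasing_seqs d n" unfolding x by simp
next
  fix x assume "x \<in> decreasing_seqs d N \<times> decreasing_seqs d n"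
  then obtain P Q where x: "x = (P, Q)" and P: "P \<in> decreasing_seqs d N" and Q: "Q \<in> decreasing_seqs d n" by blast
  obtain \<nu> where \<nu>: "young \<nu>" "length \<nu> \<le> n" "diag_squares \<nu> = d"
    "\<And>i. i < d \<Longrightarrow> frob_p \<nu> (i + 1) = P i" "\<And>i. i < d \<Longrightarrow> frob_q \<nu> (i + 1) = Q i"
    using young_of_frobenius[OF P Q] by blast
  have "frob_p_seq \<nu> = P"
    by (rule extensionalityI[OF _ decreasing_seqs_D(3)[OF P]]) (use \<nu>(4) in \<open>simp_all add: frob_p_seq_def \<nu>(3)\<close>)
  moreover have "frob_q_seq \<nu> = Q"
    by (rule extensionalityI[OF _ decreasing_seqs_D(3)[OF Q]]) (use \<nu>(5) in \<open>simp_all add: frob_q_seq_def \<nu>(3)\<close>)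
  moreover have "\<nu> \<in> ?V" using \<nu> decreasing_seqs_D(2)[OF P] by simp
  ultimately show "x \<in> ?f ` ?V" unfolding x by blast
qed


section \<open>Linear and geometric power series\<close>

definition linear_fps :: "'a::comm_ring_1 \<Rightarrow> 'a fps" where
  "linear_fps c = 1 - fps_const c * fps_X"

lemma linear_fps_nth_0 [simp]: "fps_nth (linear_fps c) 0 = 1"
  by (simp add: linear_fps_def)

lemma linear_fps_mult_nth_Suc: "fps_nth (linear_fps c * F) (Suc m) = fps_nth F (Suc m) - c * fps_nth F m"
  by (simp add: linear_fps_def left_diff_distrib mult.assoc)

lemma prod_nth_0: "(\<And>i. i \<in> I \<Longrightarrow> fps_nth (F i) 0 = 1) \<Longrightarrow> fps_nth (\<Prod>i\<in>I. F i :: 'a::comm_ring_1 fps) 0 = 1"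
  by (induction I rule: infinite_finite_induct) auto

lemma prod_linear_nth_beyond:
  assumes "finite I" "card I < m"
  shows "fps_nth (\<Prod>i\<in>I. linear_fps (a i)) m = 0"
  using assms
proof (induction I arbitrary: m rule: finite_induct)
  case (insert x I)
  then show ?case by (cases m) (simp_all add: linear_fps_mult_nth_Suc)
qed simp

definition geometric_fps :: "'a::comm_ring_1 \<Rightarrow> 'a fps" where
  "geometric_fps z = Abs_fps (\<lambda>m. z ^ m)"

lemma linear_times_geometric: "linear_fps z * geometric_fps z = 1"
proof (rule fps_ext)
  show "fps_nth (linear_fps z * geometric_fps z) m = fps_nth 1 m" for m
    by (cases m) (simp_all add: linear_fps_mult_nth_Suc geometric_fps_def)
qed

text \<open>The coefficient of $u^{-m}$ in $\prod_r (1 - c_r u^{-1})\,/\,(1 - z u^{-1})$ with $N \le m$ factors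
in the numerator. For $m = N$ this evaluates the polynomial $\prod_r (u - c_r)$ at $u = z$.\<close>

lemma prod_linear_times_geometric_nth:
  "N \<le> m \<Longrightarrow> fps_nth ((\<Prod>r<N. linear_fps (c r)) * geometric_fps z) m = z ^ (m - N) * (\<Prod>r<N. z - c r)"
proof (induction N arbitrary: m)
  case (Suc N)
  then obtain m' where m: "m = Suc m'" "N \<le> m'" by (cases m) auto
  have "fps_nth ((\<Prod>r<Suc N. linear_fps (c r)) * geometric_fps z) m =
      fps_nth (linear_fps (c N) * ((\<Prod>r<N. linear_fps (c r)) * geometric_fps z)) (Suc m')"
    by (simp add: m mult_ac)
  also have "\<dots> = z ^ (Suc m' - N) * (\<Prod>r<N. z - c r) - c N * (z ^ (m' - N) * (\<Prod>r<N. z - c r))"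
    unfolding linear_fps_mult_nth_Suc using Suc.IH[of m'] Suc.IH[of "Suc m'"] m by simp
  also have "\<dots> = z ^ (m - Suc N) * (\<Prod>r<Suc N. z - c r)"
    using m by (simp add: Suc_diff_le algebra_simps)
  finally show ?case .
qed (simp add: geometric_fps_def)

text \<open>Coefficients indexed by integers allow one formula for Jacobi--Trudi entries on both sides of the
diagonal.\<close>

definition coeff_at :: "'a::zero fps \<Rightarrow> int \<Rightarrow> 'a" where
  "coeff_at F m = (if m < 0 then 0 else fps_nth F (nat m))"

lemma coeff_at_convolution:
  fixes F E :: "'a::comm_ring_1 fps"
  assumes "\<And>s. n \<le> s \<Longrightarrow> fps_nth E s = 0"
  shows "(\<Sum>s<n. fps_nth E s * coeff_at F (m - int s)) = coeff_at (E * F) m"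
proof (cases "m < 0")
  case False
  then obtain M where M: "m = int M" using nonneg_int_cases[of m] by auto
  have c: "coeff_at F (int M - int s) = (if s \<le> M then fps_nth F (M - s) else 0)" for s
    by (auto simp: coeff_at_def nat_diff_distrib)
  have "(\<Sum>s<n. fps_nth E s * coeff_at F (m - int s)) = (\<Sum>s\<in>{..<n} \<inter> {..M}. fps_nth E s * fps_nth F (M - s))"
    unfolding M c by (subst sum.inter_restrict) (auto intro!: sum.cong)
  also have "\<dots> = (\<Sum>s\<in>{0..M}. fps_nth E s * fps_nth F (M - s))"
  proof (rule sum.mono_neutral_left)
    show "\<forall>i\<in>{0..M} - {..<n} \<inter> {..M}. fps_nth E i * fps_nth F (M - i) = 0"
    proof
      fix i assume "i \<in> {0..M} - {..<n} \<inter> {..M}"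
      then have "n \<le> i" by auto
      then show "fps_nth E i * fps_nth F (M - i) = 0" by (simp add: assms)
    qed
  qed auto
  finally show ?thesis by (simp add: M coeff_at_def fps_mult_nth)
qed (simp add: coeff_at_def)

lemma coeff_at_convolution_truncated:
  fixes F E :: "'a::comm_ring_1 fps"
  assumes "m < int n"
  shows "(\<Sum>s<n. fps_nth E s * coeff_at F (m - int s)) = coeff_at (E * F) m"
proof (cases "m < 0")
  case False
  then obtain M where M: "m = int M" using nonneg_int_cases[of m] by auto
  have "(\<Sum>s<n. fps_nth E s * coeff_at F (m - int s)) = (\<Sum>s\<in>{0..M}. fps_nth E s * coeff_at F (m - int s))"
    using assms M by (intro sum.mono_neutral_right) (auto simp: coeff_at_def)
  also have "\<dots> = (\<Sum>s\<in>{0..M}. fps_nth E s * fps_nth F (M - s))"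
    by (intro sum.cong refl arg_cong2[of _ _ _ _ "(*)"]) (auto simp: coeff_at_def M nat_diff_distrib)
  finally show ?thesis by (simp add: M coeff_at_def fps_mult_nth)
qed (simp add: coeff_at_def)


section \<open>Falling factorials as Laurent series\<close>

text \<open>The series $u^{-k} (u - \frac12)^{\downarrow k}$ in $u^{-1}$. For $k \ge 0$ it is a polynomial and for
$k < 0$ a reciprocal of one.\<close>

definition falling_fps :: "int \<Rightarrow> complex fps" where
  "falling_fps k = (if 0 \<le> k then \<Prod>r<nat k. linear_fps (of_nat r + 1/2)
     else inverse (\<Prod>r<nat (- k). linear_fps (- of_nat r - 1/2)))"

lemma falling_fps_nonneg: "falling_fps (int p) = (\<Prod>r<p. linear_fps (of_nat r + 1/2))"
  by (simp add: falling_fps_def)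

lemma falling_fps_neg: "falling_fps (- int m) * (\<Prod>r<m. linear_fps (- of_nat r - 1/2)) = 1"
proof (cases "m = 0")
  case False
  then show ?thesis
    by (simp add: falling_fps_def) (intro inverse_mult_eq_1, simp add: prod_nth_0)
qed (simp add: falling_fps_def)

lemma falling_fps_nth_0 [simp]: "fps_nth (falling_fps k) 0 = 1"
  by (simp add: falling_fps_def prod_nth_0)

lemma falling_fps_rec: "falling_fps (k + 1) = falling_fps k * linear_fps (of_int k + 1/2)"
proof (cases "0 \<le> k")
  case True
  then obtain p where p: "k = int p" using nonneg_int_cases[of k] by auto
  have "falling_fps (int (Suc p)) = falling_fps (int p) * linear_fps (of_nat p + 1/2)"
    unfolding falling_fps_nonneg by simp
  then show ?thesis by (simp add: p algebra_simps)
next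
  case False
  define m where "m = nat (- k - 1)"
  have k: "k = - int (Suc m)" using False by (simp add: m_def)
  let ?Q = "\<lambda>m. \<Prod>r<m. linear_fps (- of_nat r - 1/2) :: complex fps"
  have nz: "?Q m \<noteq> 0" by (metis falling_fps_neg mult_zero_right zero_neq_one)
  have "falling_fps (- int (Suc m)) * linear_fps (- of_nat m - 1/2) * ?Q m = falling_fps (- int m) * ?Q m"
    unfolding falling_fps_neg using falling_fps_neg[of "Suc m"] by (simp add: mult_ac)
  then have "falling_fps (- int (Suc m)) * linear_fps (- of_nat m - 1/2) = falling_fps (- int m)"
    using nz by simp
  moreover have "k + 1 = - int m" "of_int k + 1/2 = (- of_nat m - 1/2 :: complex)" by (simp_all add: k)
  ultimately show ?thesis by (simp only: k)
qed

text \<open>In terms of $u$ this says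
$(u - \frac12)^{\downarrow (N - n)} (u + \frac12) \cdots (u + n - \frac12) = \prod_{r < N} (u + n - \frac12 - r)$,
which is uniform in the sign of $N - n$.\<close>

lemma falling_fps_clear_denominator:
  "falling_fps (int N - int n) * (\<Prod>r<n. linear_fps (- of_nat r - 1/2)) =
     (\<Prod>r<N. linear_fps (of_nat r - of_nat n + 1/2))"
proof (induction N)
  case 0
  then show ?case using falling_fps_neg[of n] by simp
next
  case (Suc N)
  have "int (Suc N) - int n = (int N - int n) + 1" "of_int (int N - int n) + 1/2 = (of_nat N - of_nat n + 1/2 :: complex)"
    by simp_all
  then have "falling_fps (int (Suc N) - int n) = falling_fps (int N - int n) * linear_fps (of_nat N - of_nat n + 1/2)"
    by (simp only: falling_fps_rec)
  then show ?case by (simp only: prod.lessThan_Suc Suc.IH[symmetric] mult_ac)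
qed

lemma prod_linear_nth:
  fixes a :: "'b \<Rightarrow> complex"
  assumes "finite I"
  shows "fps_nth (\<Prod>i\<in>I. linear_fps (a i)) k = (-1) ^ k * esym k I a"
proof -
  have "(\<Prod>i\<in>I. linear_fps (a i)) = (\<Prod>i\<in>I. fps_const (- a i) * fps_X + 1)"
    by (intro prod.cong refl) (simp add: linear_fps_def flip: fps_const_neg)
  also have "\<dots> = (\<Sum>X\<in>Pow I. (\<Prod>i\<in>X. fps_const (- a i) * fps_X))"
    using assms by (subst prod_add) simp_all
  also have "\<dots> = (\<Sum>X\<in>Pow I. fps_const (\<Prod>i\<in>X. - a i) * fps_X ^ card X)"
  proof (rule sum.cong[OF refl])
    fix X assume "X \<in> Pow I"
    then have "finite X" using assms finite_subset by auto
    then show "(\<Prod>i\<in>X. fps_const (- a i) * fps_X) = fps_const (\<Prod>i\<in>X. - a i) * fps_X ^ card X"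
    proof (induction X rule: finite_induct)
      case (insert x F)
      have "(\<Prod>i\<in>insert x F. fps_const (- a i) * fps_X) =
          (fps_const (- a x) * fps_const (\<Prod>i\<in>F. - a i)) * fps_X ^ Suc (card F)"
        by (simp only: prod.insert[OF insert(1,2)] insert(3)) (simp only: power_Suc mult_ac)
      then show ?case
        by (simp only: fps_const_mult prod.insert[OF insert(1,2)] card_insert_disjoint[OF insert(1,2)])
    qed simp
  qed
  also have "fps_nth \<dots> k = (\<Sum>X\<in>Pow I. if card X = k then (\<Prod>i\<in>X. - a i) else 0)"
    by (auto simp: fps_sum_nth intro!: sum.cong)
  also have "\<dots> = (\<Sum>X | X \<subseteq> I \<and> card X = k. (\<Prod>i\<in>X. - a i))"
    using assms by (subst sum.inter_filter[symmetric]) (auto intro!: sum.cong)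
  also have "\<dots> = (-1) ^ k * esym k I a"
    unfolding esym_def sum_distrib_left by (intro sum.cong refl) (auto simp: prod_uminus)
  finally show ?thesis .
qed

text \<open>The numbers $c_{pp'}$ are the coefficients of $u^{p'}$ in $(u - \frac12)^{\downarrow p}$.\<close>

lemma hook_coeff_falling:
  assumes "p' \<le> p"
  shows "hook_coeff p p' = fps_nth (falling_fps (int p)) (p - p')"
proof -
  have "falling_fps (int p) = (\<Prod>i\<in>{1..p}. linear_fps ((2 * of_nat i - 1) / 2))"
    unfolding falling_fps_nonneg by (intro prod.reindex_bij_witness[of _ "\<lambda>i. i - 1" Suc]) (auto simp: field_simps)
  then show ?thesis using assms by (simp add: hook_coeff_def prod_linear_nth)
qed

lemma falling_fps_nth_beyond: "p < m \<Longrightarrow> fps_nth (falling_fps (int p)) m = 0"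
  unfolding falling_fps_nonneg by (rule prod_linear_nth_beyond) auto

text \<open>The sum over $r$ is the coefficient of $u^{-1}$ in the product of
$1/((u + \frac12)\cdots(u + q + \frac12))$ with the polynomial $(u + \frac12)\cdots(u + c - \frac12)$. For
$c > q$ the product is a polynomial. For $c < q$ it is $O(u^{-2})$. For $c = q$ it is $1/(u + q + \frac12)$.\<close>

lemma dual_falling_nth:
  "(\<Sum>r<n. (if q \<le> r then fps_nth (falling_fps (- int q - 1)) (r - q) else 0) * ((-1) ^ (c + r) * hook_coeff c r)) =
    (if c = q then 1 else 0)" if "c < n"
proof -
  define R where "R = (\<Prod>i<c. linear_fps (- of_nat i - 1/2 :: complex))"
  have R: "(-1) ^ (c + r) * hook_coeff c r = fps_nth R (c - r)" if "r \<le> c" for r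
  proof -
    have minus: "- of_nat i - 1/2 = - (of_nat i + 1/2 :: complex)" for i by simp
    have "fps_nth R (c - r) = (-1) ^ (c - r) * esym (c - r) {..<c} (\<lambda>i. - (of_nat i + 1/2))"
      unfolding R_def minus by (rule prod_linear_nth) simp
    also have "esym (c - r) {..<c} (\<lambda>i. - (of_nat i + 1/2)) = (-1) ^ (c - r) * esym (c - r) {..<c} (\<lambda>i. of_nat i + 1/2)"
      unfolding esym_def sum_distrib_left prod_uminus by (intro sum.cong refl) simp
    also have "(-1) ^ (c - r) * \<dots> = (-1) ^ (c - r) * fps_nth (falling_fps (int c)) (c - r)"
      unfolding falling_fps_nonneg by (simp add: prod_linear_nth)
    also have "\<dots> = (-1) ^ (c + r) * hook_coeff c r"
      using that by (auto simp: hook_coeff_falling minus_one_power_iff)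
    finally show ?thesis ..
  qed
  have zero: "hook_coeff c r = 0" if "c < r" for r using that by (simp add: hook_coeff_def)
  show ?thesis
  proof (cases "q \<le> c")
    case False
    then show ?thesis by (intro sum.neutral[THEN trans]) (auto simp: hook_coeff_def)
  next
    case True
    have "(\<Sum>r<n. (if q \<le> r then fps_nth (falling_fps (- int q - 1)) (r - q) else 0) * ((-1) ^ (c + r) * hook_coeff c r)) =
        (\<Sum>r\<in>{q..c}. fps_nth (falling_fps (- int q - 1)) (r - q) * fps_nth R (c - r))"
      using \<open>c < n\<close> by (intro sum.mono_neutral_cong_right) (auto simp: zero R)
    also have "\<dots> = (\<Sum>s\<in>{0..c - q}. fps_nth (falling_fps (- int q - 1)) s * fps_nth R (c - q - s))"
      using True by (intro sum.reindex_bij_witness[of _ "\<lambda>s. s + q" "\<lambda>r. r - q"]) auto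
    also have "\<dots> = fps_nth (falling_fps (- int q - 1) * R) (c - q)"
      by (simp add: fps_mult_nth)
    also have "\<dots> = (if c = q then 1 else 0)"
    proof (cases "c = q")
      case False
      then have split: "{..<c} = {..<Suc q} \<union> {Suc q..<c}" using True by auto
      have "R = (\<Prod>i<Suc q. linear_fps (- of_nat i - 1/2)) * (\<Prod>i\<in>{Suc q..<c}. linear_fps (- of_nat i - 1/2))"
        unfolding R_def split by (rule prod.union_disjoint) auto
      moreover have "- int (Suc q) = - int q - 1" by simp
      note f = falling_fps_neg[of "Suc q", unfolded this]
      ultimately have "falling_fps (- int q - 1) * R = (\<Prod>i\<in>{Suc q..<c}. linear_fps (- of_nat i - 1/2))"
        by (simp only: mult.assoc[symmetric] f mult_1)
      then show ?thesis using False True by (simp add: prod_linear_nth_beyond)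
    qed (simp add: R_def prod_nth_0)
    finally show ?thesis .
  qed
qed


section \<open>Reciprocal falling factorials and the shift by one half\<close>

lemma inv_falling_Suc: "inv_falling (Suc k) * linear_fps (of_nat k) = fps_X * inv_falling k"
proof -
  have "inverse (1 - fps_const (of_nat k) * fps_X :: complex fps) * (1 - fps_const (of_nat k) * fps_X) = 1"
    by (intro inverse_mult_eq_1) simp
  then show ?thesis
    by (simp add: inv_falling_def linear_fps_def fps_divide_unit mult_ac)
qed

lemma inv_falling_nth_below: "m < k \<Longrightarrow> fps_nth (inv_falling k) m = 0"
proof (induction k arbitrary: m)
  case (Suc k)
  show ?case using Suc.prems
  proof (induction m)
    case 0
    have "fps_nth (inv_falling (Suc k) * linear_fps (of_nat k)) 0 = 0" unfolding inv_falling_Suc by simp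
    then show ?case by simp
  next
    case (Suc m)
    have "fps_nth (linear_fps (of_nat k) * inv_falling (Suc k)) (Suc m) = fps_nth (inv_falling k) m"
      by (subst mult.commute) (simp add: inv_falling_Suc)
    then show ?case using Suc \<open>\<And>m. m < k \<Longrightarrow> fps_nth (inv_falling k) m = 0\<close>
      by (simp add: linear_fps_mult_nth_Suc)
  qed
qed simp

lemma inv_u_plus_half: "inv_u_plus_half * linear_fps (- 1/2) = fps_X"
proof -
  have "inverse (1 + fps_const (1/2) * fps_X :: complex fps) * (1 + fps_const (1/2) * fps_X) = 1"
    by (intro inverse_mult_eq_1) simp
  moreover have "linear_fps (- 1/2) = (1 + fps_const (1/2) * fps_X :: complex fps)"
    by (simp add: linear_fps_def flip: fps_const_neg)
  ultimately show ?thesis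
    by (simp add: inv_u_plus_half_def fps_divide_unit mult.assoc)
qed

text \<open>The coefficient of $u^l$ in $(u - \frac12)^{\downarrow k}$; as a function of $k$ and $l$ it is defined
for all arguments, which is convenient for the recurrence below.\<close>

definition falling_coeff :: "nat \<Rightarrow> nat \<Rightarrow> complex" where
  "falling_coeff k l = (if l \<le> k then fps_nth (falling_fps (int k)) (k - l) else 0)"

text \<open>Comparison of coefficients in
$(u - \frac12)^{\downarrow (k + 1)} = (u - k - \frac12)\,(u - \frac12)^{\downarrow k}$.\<close>

lemma falling_coeff_Suc:
  "(of_nat k + 1/2) * falling_coeff k l = (if l = 0 then 0 else falling_coeff k (l - 1)) - falling_coeff (Suc k) l"
proof -
  have rec: "falling_fps (int (Suc k)) = linear_fps (of_nat k + 1/2) * falling_fps (int k)"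
    using falling_fps_rec[of "int k"] by (simp add: algebra_simps)
  consider "l = 0" | "0 < l" "l \<le> k" | "l = Suc k" | "Suc k < l" by linarith
  then show ?thesis
  proof cases
    case 1
    then show ?thesis
      by (simp add: falling_coeff_def rec linear_fps_mult_nth_Suc falling_fps_nth_beyond del: of_nat_Suc)
  next
    case 2
    then have "Suc k - l = Suc (k - l)" "k - (l - 1) = Suc (k - l)" by auto
    with 2 show ?thesis
      by (simp add: falling_coeff_def rec linear_fps_mult_nth_Suc del: of_nat_Suc)
  qed (auto simp: falling_coeff_def)
qed

text \<open>The expansion of $(u + \frac12)^{-l-1}$ in the reciprocals $1/u^{\downarrow (k+1)}$, truncated to
coefficients where the tail does not matter. Multiplication by $u + \frac12$ sends $1/u^{\downarrow (k+1)}$ to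
$1/u^{\downarrow k} + (k + \frac12)/u^{\downarrow (k+1)}$. By \<open>falling_coeff_Suc\<close> the resulting sum telescopes
to the sum for $l - 1$, up to a multiple of the last reciprocal $1/u^{\downarrow K}$.\<close>

lemma inv_u_plus_half_power_expansion:
  assumes "m \<le> K"
  shows "(\<Sum>k<K. falling_coeff k l * fps_nth (inv_falling (Suc k)) m) = fps_nth (inv_u_plus_half ^ Suc l) m"
proof -
  let ?Y = inv_u_plus_half and ?V = inv_falling
  \<comment> \<open>\<open>P l\<close> is what \<open>F l\<close> becomes after multiplication by \<open>u + 1/2\<close>, up to the tail.\<close>
  define F where "F = (\<lambda>l. \<Sum>k<K. fps_const (falling_coeff k l) * ?V (Suc k))"
  define P where "P = (\<lambda>l. if l = 0 then 1 else F (l - 1))"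
  have V: "linear_fps (- 1/2) * ?V (Suc k) = fps_X * (?V k + fps_const (of_nat k + 1/2) * ?V (Suc k))" for k
  proof -
    have "linear_fps (- 1/2) = linear_fps (of_nat k) + fps_X * fps_const (of_nat k + 1/2 :: complex)"
      unfolding linear_fps_def by (rule fps_ext) simp
    then show ?thesis using inv_falling_Suc[of k] by (simp add: algebra_simps)
  qed
  have step: "F l = ?Y * (P l - fps_const (falling_coeff K l) * ?V K)" for l
  proof -
    have P': "P l = fps_const (falling_coeff 0 l) * ?V 0 +
        (\<Sum>k<K. fps_const (if l = 0 then 0 else falling_coeff k (l - 1)) * ?V (Suc k))"
      by (auto simp: P_def F_def falling_coeff_def inv_falling_def)
    have "linear_fps (- 1/2) * F l = (\<Sum>k<K. fps_const (falling_coeff k l) * (linear_fps (- 1/2) * ?V (Suc k)))"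
      by (simp add: F_def sum_distrib_left mult_ac)
    also have "\<dots> = fps_X * (\<Sum>k<K. fps_const (falling_coeff k l) * ?V k +
        fps_const ((of_nat k + 1/2) * falling_coeff k l) * ?V (Suc k))"
      unfolding V sum_distrib_left
    proof (intro sum.cong refl)
      fix k
      have "fps_const ((of_nat k + 1/2) * falling_coeff k l) = fps_const (of_nat k + 1/2) * fps_const (falling_coeff k l)"
        by (simp only: fps_const_mult)
      then show "fps_const (falling_coeff k l) * (fps_X * (?V k + fps_const (of_nat k + 1/2) * ?V (Suc k))) =
          fps_X * (fps_const (falling_coeff k l) * ?V k + fps_const ((of_nat k + 1/2) * falling_coeff k l) * ?V (Suc k))"
        by (simp only: distrib_left mult_ac)
    qed
    also have "(\<Sum>k<K. fps_const (falling_coeff k l) * ?V k + fps_const ((of_nat k + 1/2) * falling_coeff k l) * ?V (Suc k)) =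
        (\<Sum>k<K. fps_const (if l = 0 then 0 else falling_coeff k (l - 1)) * ?V (Suc k)) -
        (\<Sum>k<K. fps_const (falling_coeff (Suc k) l) * ?V (Suc k) - fps_const (falling_coeff k l) * ?V k)"
      unfolding falling_coeff_Suc sum_subtractf[symmetric]
      by (intro sum.cong refl) (simp add: algebra_simps flip: fps_const_sub)
    also have "\<dots> = P l - fps_const (falling_coeff K l) * ?V K"
      unfolding P' by (subst sum_lessThan_telescope) simp
    finally have "linear_fps (- 1/2) * F l = fps_X * (P l - fps_const (falling_coeff K l) * ?V K)" .
    also have "\<dots> = linear_fps (- 1/2) * (?Y * (P l - fps_const (falling_coeff K l) * ?V K))"
      using inv_u_plus_half by (simp add: mult_ac)
    moreover have "linear_fps (- 1/2 :: complex) \<noteq> 0"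
      by (metis linear_fps_nth_0 fps_zero_nth zero_neq_one)
    ultimately show ?thesis by simp
  qed
  have Y0: "fps_nth ?Y 0 = 0"
    using arg_cong[OF inv_u_plus_half, of "\<lambda>F. fps_nth F 0"] by simp
  have "fps_nth (F l) m = fps_nth (?Y ^ Suc l) m" if "m \<le> K" for m l
    using that
  proof (induction l arbitrary: m)
    case 0
    have "fps_nth (?Y * (fps_const (falling_coeff K 0) * ?V K)) m = 0"
      using 0 unfolding fps_mult_nth[of ?Y]
    proof (intro sum.neutral ballI)
      fix i assume "i \<in> {0..m}"
      then show "fps_nth ?Y i * fps_nth (fps_const (falling_coeff K 0) * ?V K) (m - i) = 0"
        using 0 by (cases "i = 0") (simp_all add: Y0 inv_falling_nth_below)
    qed
    then show ?case by (subst step) (simp add: P_def right_diff_distrib)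
  next
    case (Suc l)
    have "fps_nth (?Y * (F l - fps_const (falling_coeff K (Suc l)) * ?V K)) m = fps_nth (?Y * ?Y ^ Suc l) m"
      unfolding fps_mult_nth[of ?Y]
    proof (intro sum.cong refl)
      fix i assume "i \<in> {0..m}"
      then show "fps_nth ?Y i * fps_nth (F l - fps_const (falling_coeff K (Suc l)) * ?V K) (m - i) =
          fps_nth ?Y i * fps_nth (?Y ^ Suc l) (m - i)"
        using Suc.prems Suc.IH[of "m - i"] by (cases "i = 0") (simp_all add: Y0 inv_falling_nth_below)
    qed
    then show ?case by (subst step) (simp add: P_def)
  qed
  then show ?thesis using assms by (simp add: F_def fps_sum_nth)
qed


section \<open>The polynomial ring and substitution\<close>

lemma const_0 [simp]: "const 0 = 0" and const_1 [simp]: "const 1 = 1"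
  by (simp_all add: const_def)

lemma const_add: "const (a + b) = const a + const b"
  and const_minus: "const (- a) = - const a"
  and const_diff: "const (a - b) = const a - const b"
  and const_mult: "const (a * b) = const a * const b"
  by (simp_all add: const_def single_add single_uminus single_diff mult_single)

lemma const_of_nat: "const (of_nat n) = of_nat n"
  by (induction n) (simp_all add: const_add)

lemma const_of_int: "const (of_int n) = of_int n"
  by (cases n rule: int_diff_cases) (simp add: const_diff const_of_nat)

lemma const_power: "const (a ^ n) = const a ^ n"
  by (induction n) (simp_all add: const_mult)

lemma const_sum: "const (sum f S) = (\<Sum>x\<in>S. const (f x))"
  by (induction S rule: infinite_finite_induct) (simp_all add: const_add)

lemma const_fdet: "const (fdet n f) = fdet n (\<lambda>i j. const (f i j))"
  by (rule fdet_hom) (simp_all add: const_add const_mult)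

definition const_fps :: "complex fps \<Rightarrow> cpoly fps" where
  "const_fps F = Abs_fps (\<lambda>m. const (fps_nth F m))"

lemma const_fps_nth [simp]: "fps_nth (const_fps F) m = const (fps_nth F m)"
  by (simp add: const_fps_def)

lemma const_fps_1 [simp]: "const_fps 1 = 1"
  by (rule fps_ext) simp

lemma const_fps_mult: "const_fps (F * G) = const_fps F * const_fps G"
  by (rule fps_ext) (simp add: fps_mult_nth const_sum const_mult)

lemma const_fps_power: "const_fps (F ^ n) = const_fps F ^ n"
  by (induction n) (simp_all add: const_fps_mult)

lemma const_fps_linear: "const_fps (linear_fps c) = linear_fps (const c)"
  by (rule fps_ext) (simp add: linear_fps_def fps_X_def const_diff const_mult)

lemma const_fps_prod: "const_fps (\<Prod>i\<in>I. F i) = (\<Prod>i\<in>I. const_fps (F i))"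
  by (induction I rule: infinite_finite_induct) (simp_all add: const_fps_mult)

text \<open>Reduces multiplicativity of substitution to single monomials.\<close>

lemma cpoly_sum_monomials:
  fixes f :: cpoly
  shows "f = (\<Sum>m\<in>Poly_Mapping.keys f. Poly_Mapping.single m (Poly_Mapping.lookup f m))"
proof (rule poly_mapping_eqI)
  fix m
  have "Poly_Mapping.lookup (\<Sum>m\<in>Poly_Mapping.keys f. Poly_Mapping.single m (Poly_Mapping.lookup f m)) m =
      (\<Sum>k\<in>Poly_Mapping.keys f. if k = m then Poly_Mapping.lookup f k else 0)"
    unfolding lookup_sum by (intro sum.cong refl) (simp add: lookup_single when_def)
  also have "\<dots> = Poly_Mapping.lookup f m" by (simp add: in_keys_iff)
  finally show "Poly_Mapping.lookup f m = Poly_Mapping.lookup (\<Sum>m\<in>Poly_Mapping.keys f. Poly_Mapping.single m (Poly_Mapping.lookup f m)) m" ..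
qed

lemma subst_poly_superset:
  assumes "finite A" "Poly_Mapping.keys f \<subseteq> A"
  shows "subst_poly \<sigma> f = (\<Sum>m\<in>A. const (Poly_Mapping.lookup f m) * (\<Prod>i\<in>Poly_Mapping.keys m. \<sigma> i ^ Poly_Mapping.lookup m i))"
  unfolding subst_poly_def using assms by (intro sum.mono_neutral_left) (auto simp: in_keys_iff)

lemma subst_poly_add: "subst_poly \<sigma> (f + g) = subst_poly \<sigma> f + subst_poly \<sigma> g"
proof -
  let ?A = "Poly_Mapping.keys f \<union> Poly_Mapping.keys g"
  have "Poly_Mapping.keys (f + g) \<subseteq> ?A" by (rule keys_add)
  then show ?thesis
    by (simp add: subst_poly_superset[of ?A] lookup_add const_add distrib_right sum.distrib)
qed

lemma subst_poly_0 [simp]: "subst_poly \<sigma> 0 = 0"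
  by (simp add: subst_poly_def)

lemma subst_poly_sum: "subst_poly \<sigma> (sum f S) = (\<Sum>x\<in>S. subst_poly \<sigma> (f x))"
  by (induction S rule: infinite_finite_induct) (simp_all add: subst_poly_add)

lemma subst_poly_single:
  "subst_poly \<sigma> (Poly_Mapping.single m c) = const c * (\<Prod>i\<in>Poly_Mapping.keys m. \<sigma> i ^ Poly_Mapping.lookup m i)"
  by (subst subst_poly_superset[of "{m}"]) auto

lemma subst_poly_mult: "subst_poly \<sigma> (f * g) = subst_poly \<sigma> f * subst_poly \<sigma> g"
proof -
  have monomial: "(\<Prod>i\<in>Poly_Mapping.keys (m + m'). \<sigma> i ^ Poly_Mapping.lookup (m + m') i) =
      (\<Prod>i\<in>Poly_Mapping.keys m. \<sigma> i ^ Poly_Mapping.lookup m i) * (\<Prod>i\<in>Poly_Mapping.keys m'. \<sigma> i ^ Poly_Mapping.lookup m' i)"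
    for m m' :: "nat \<Rightarrow>\<^sub>0 nat"
  proof -
    let ?A = "Poly_Mapping.keys m \<union> Poly_Mapping.keys m'"
    have *: "(\<Prod>i\<in>Poly_Mapping.keys k. \<sigma> i ^ Poly_Mapping.lookup k i) = (\<Prod>i\<in>?A. \<sigma> i ^ Poly_Mapping.lookup k i)"
      if "Poly_Mapping.keys k \<subseteq> ?A" for k
      using that by (intro prod.mono_neutral_left) (auto simp: in_keys_iff)
    have "(\<Prod>i\<in>Poly_Mapping.keys (m + m'). \<sigma> i ^ Poly_Mapping.lookup (m + m') i) =
        (\<Prod>i\<in>?A. \<sigma> i ^ Poly_Mapping.lookup (m + m') i)"
      by (rule *[OF keys_add])
    then show ?thesis
      unfolding *[of m, OF Un_upper1] *[of m', OF Un_upper2] by (simp add: lookup_add power_add prod.distrib)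
  qed
  have single: "subst_poly \<sigma> (Poly_Mapping.single m c * Poly_Mapping.single m' c') =
      subst_poly \<sigma> (Poly_Mapping.single m c) * subst_poly \<sigma> (Poly_Mapping.single m' c')" for m m' c c'
    by (simp add: mult_single subst_poly_single monomial const_mult mult_ac)
  let ?f = "\<lambda>m. Poly_Mapping.single m (Poly_Mapping.lookup f m)" and ?g = "\<lambda>m. Poly_Mapping.single m (Poly_Mapping.lookup g m)"
  have "subst_poly \<sigma> ((\<Sum>m\<in>Poly_Mapping.keys f. ?f m) * (\<Sum>m\<in>Poly_Mapping.keys g. ?g m)) =
      subst_poly \<sigma> (\<Sum>m\<in>Poly_Mapping.keys f. ?f m) * subst_poly \<sigma> (\<Sum>m\<in>Poly_Mapping.keys g. ?g m)"
    by (simp only: sum_product subst_poly_sum single)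
  then show ?thesis by (simp flip: cpoly_sum_monomials)
qed

lemma subst_poly_const [simp]: "subst_poly \<sigma> (const c) = const c"
  by (simp add: const_def[of c] subst_poly_single)

lemma subst_poly_1 [simp]: "subst_poly \<sigma> 1 = 1"
  using subst_poly_const[of \<sigma> 1] by (simp del: subst_poly_const)

lemma subst_poly_var [simp]: "subst_poly \<sigma> (var i) = \<sigma> i"
  by (simp add: var_def subst_poly_single)

lemma subst_poly_diff: "subst_poly \<sigma> (f - g) = subst_poly \<sigma> f - subst_poly \<sigma> g"
  using subst_poly_add[of \<sigma> "f - g" g] by simp

lemma subst_poly_of_nat [simp]: "subst_poly \<sigma> (of_nat n) = of_nat n"
  by (metis const_of_nat subst_poly_const)

lemma subst_poly_power: "subst_poly \<sigma> (f ^ n) = subst_poly \<sigma> f ^ n"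
  by (induction n) (simp_all add: subst_poly_mult)

lemma subst_poly_prod: "subst_poly \<sigma> (\<Prod>i\<in>I. f i) = (\<Prod>i\<in>I. subst_poly \<sigma> (f i))"
  by (induction I rule: infinite_finite_induct) (simp_all add: subst_poly_mult)

lemma subst_poly_fdet: "subst_poly \<sigma> (fdet n f) = fdet n (\<lambda>i j. subst_poly \<sigma> (f i j))"
  by (rule fdet_hom) (simp_all add: subst_poly_add subst_poly_mult)


section \<open>Variables and degree\<close>

lemma poly_vars_add: "poly_vars f \<subseteq> V \<Longrightarrow> poly_vars g \<subseteq> V \<Longrightarrow> poly_vars (f + g) \<subseteq> V"
  using keys_add[of f g] unfolding poly_vars_def UN_subset_iff by blast

lemma poly_vars_mult: "poly_vars f \<subseteq> V \<Longrightarrow> poly_vars g \<subseteq> V \<Longrightarrow> poly_vars (f * g) \<subseteq> V"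
proof -
  assume fg: "poly_vars f \<subseteq> V" "poly_vars g \<subseteq> V"
  have "Poly_Mapping.keys m \<subseteq> V" if m_in: "m \<in> Poly_Mapping.keys (f * g)" for m
  proof -
    obtain a b where m: "m = a + b" and ab: "a \<in> Poly_Mapping.keys f" "b \<in> Poly_Mapping.keys g"
      using subsetD[OF keys_mult m_in] by blast
    have "Poly_Mapping.keys a \<subseteq> V" "Poly_Mapping.keys b \<subseteq> V"
      using fg ab unfolding poly_vars_def by blast+
    then show ?thesis using keys_add[of a b] unfolding m by blast
  qed
  then show ?thesis unfolding poly_vars_def by blast
qed

lemma poly_vars_const [simp]: "poly_vars (const c) = {}"
  by (simp add: poly_vars_def const_def)

lemma poly_vars_var [simp]: "poly_vars (var i) = {i}"
  by (simp add: poly_vars_def var_def)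

lemma degree_le_mono: "degree_le a f \<Longrightarrow> a \<le> b \<Longrightarrow> degree_le b f"
  unfolding degree_le_def using le_trans by blast

lemma degree_le_add: "degree_le D f \<Longrightarrow> degree_le D g \<Longrightarrow> degree_le D (f + g)"
  unfolding degree_le_def using keys_add[of f g] by blast

lemma degree_le_const: "degree_le D (const c)"
  by (simp add: degree_le_def const_def)

lemma degree_le_var: "degree_le 1 (var i)"
  by (simp add: degree_le_def var_def)

lemma degree_le_mult:
  assumes "degree_le a f" "degree_le b g"
  shows "degree_le (a + b) (f * g)"
  unfolding degree_le_def
proof
  fix m assume "m \<in> Poly_Mapping.keys (f * g)"
  then obtain k l where m: "m = k + l" and kl: "k \<in> Poly_Mapping.keys f" "l \<in> Poly_Mapping.keys g"
    using keys_mult[of f g] by blast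
  let ?A = "Poly_Mapping.keys k \<union> Poly_Mapping.keys l"
  have *: "(\<Sum>i\<in>Poly_Mapping.keys n. Poly_Mapping.lookup n i) = (\<Sum>i\<in>?A. Poly_Mapping.lookup n i)"
    if "Poly_Mapping.keys n \<subseteq> ?A" for n :: "nat \<Rightarrow>\<^sub>0 nat"
    using that by (intro sum.mono_neutral_left) (auto simp: in_keys_iff)
  have "(\<Sum>i\<in>Poly_Mapping.keys m. Poly_Mapping.lookup m i) = (\<Sum>i\<in>?A. Poly_Mapping.lookup m i)"
    unfolding m by (rule *[OF keys_add])
  then have "(\<Sum>i\<in>Poly_Mapping.keys m. Poly_Mapping.lookup m i) =
      (\<Sum>i\<in>Poly_Mapping.keys k. Poly_Mapping.lookup k i) + (\<Sum>i\<in>Poly_Mapping.keys l. Poly_Mapping.lookup l i)"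
    unfolding *[of k, OF Un_upper1] *[of l, OF Un_upper2] by (simp add: m lookup_add sum.distrib)
  then show "(\<Sum>i\<in>Poly_Mapping.keys m. Poly_Mapping.lookup m i) \<le> a + b"
    using assms kl unfolding degree_le_def by (simp add: add_mono)
qed

lemma degree_le_power: "degree_le 1 f \<Longrightarrow> degree_le m (f ^ m)"
proof (induction m)
  case 0
  show ?case using degree_le_const[of 0 1] by simp
next
  case (Suc m)
  then show ?case using degree_le_mult[of 1 f m "f ^ m"] by simp
qed

text \<open>The coefficient of $u^{-m}$ has degree at most $m$ in all the series considered here, a property that
is inherited by products.\<close>

lemma degree_le_fps_mult:
  assumes "\<And>m. degree_le m (fps_nth F m)" "\<And>m. degree_le m (fps_nth G m)"
  shows "degree_le m (fps_nth (F * G) m)"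
proof -
  have "degree_le m (\<Sum>i\<in>S. fps_nth F i * fps_nth G (m - i))" if "finite S" "S \<subseteq> {0..m}" for S
    using that
  proof (induction S rule: finite_induct)
    case (insert i S)
    have "degree_le (i + (m - i)) (fps_nth F i * fps_nth G (m - i))"
      using assms by (intro degree_le_mult)
    then show ?case using insert by (simp add: degree_le_add)
  qed (use degree_le_const[of m 0] in simp)
  then show ?thesis by (simp add: fps_mult_nth)
qed

lemma degree_le_fps_prod:
  assumes "\<And>i m. i \<in> I \<Longrightarrow> degree_le m (fps_nth (F i) m)"
  shows "degree_le m (fps_nth (\<Prod>i\<in>I. F i) m)"
  using assms
proof (induction I arbitrary: m rule: infinite_finite_induct)
  case (insert i I)
  then show ?case by (simp add: degree_le_fps_mult)
qed (use degree_le_const[of _ 0] degree_le_const[of _ 1] in auto)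

lemma poly_vars_fps_mult:
  assumes "\<And>m. poly_vars (fps_nth F m) \<subseteq> V" "\<And>m. poly_vars (fps_nth G m) \<subseteq> V"
  shows "poly_vars (fps_nth (F * G) m) \<subseteq> V"
proof -
  have "poly_vars (\<Sum>i\<in>S. fps_nth F i * fps_nth G (m - i)) \<subseteq> V" if "finite S" for S
    using that
  proof (induction S rule: finite_induct)
    case (insert i S)
    then show ?case using assms by (simp add: poly_vars_add poly_vars_mult)
  qed (use poly_vars_const[of 0] in simp)
  then show ?thesis by (simp add: fps_mult_nth)
qed

lemma poly_vars_fps_prod:
  assumes "\<And>i m. i \<in> I \<Longrightarrow> poly_vars (fps_nth (F i) m) \<subseteq> V"
  shows "poly_vars (fps_nth (\<Prod>i\<in>I. F i) m) \<subseteq> V"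
  using assms
proof (induction I arbitrary: m rule: infinite_finite_induct)
  case (insert i I)
  then show ?case by (simp add: poly_vars_fps_mult)
qed (use poly_vars_const[of 0] poly_vars_const[of 1] in auto)

lemma poly_vars_power: "poly_vars f \<subseteq> V \<Longrightarrow> poly_vars (f ^ m) \<subseteq> V"
proof (induction m)
  case 0
  show ?case using poly_vars_const[of 1] by simp
qed (simp add: poly_vars_mult)

definition subst_fps :: "(nat \<Rightarrow> cpoly) \<Rightarrow> cpoly fps \<Rightarrow> cpoly fps" where
  "subst_fps \<sigma> F = Abs_fps (\<lambda>m. subst_poly \<sigma> (fps_nth F m))"

lemma subst_fps_nth: "fps_nth (subst_fps \<sigma> F) m = subst_poly \<sigma> (fps_nth F m)"
  by (simp add: subst_fps_def)

lemma subst_fps_mult: "subst_fps \<sigma> (F * G) = subst_fps \<sigma> F * subst_fps \<sigma> G"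
  by (rule fps_ext) (simp add: subst_fps_nth fps_mult_nth subst_poly_sum subst_poly_mult)

lemma subst_fps_prod: "subst_fps \<sigma> (\<Prod>i\<in>I. F i) = (\<Prod>i\<in>I. subst_fps \<sigma> (F i))"
proof (induction I rule: infinite_finite_induct)
  case empty
  show ?case by (rule fps_ext) (simp add: subst_fps_nth)
next
  case (infinite A)
  then show ?case by (simp, intro fps_ext) (simp add: subst_fps_nth)
qed (simp_all add: subst_fps_mult)

lemma subst_fps_const [simp]: "subst_fps \<sigma> (const_fps F) = const_fps F"
  by (rule fps_ext) (simp add: subst_fps_nth)

lemma subst_fps_geometric: "subst_fps \<sigma> (geometric_fps z) = geometric_fps (subst_poly \<sigma> z)"
  by (rule fps_ext) (simp add: subst_fps_nth geometric_fps_def subst_poly_power)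


section \<open>The generating series of $\Lambda^*$ in centred coordinates\<close>

text \<open>The product $\prod_{i \le n} (u + i - \frac12)/(u - y_i - \frac12)$, expanded in $u^{-1}$, for arbitrary
arguments $y_i$. Keeping the arguments free lets substitutions act on them alone.\<close>

definition shifted_gen :: "nat \<Rightarrow> (nat \<Rightarrow> cpoly) \<Rightarrow> cpoly fps" where
  "shifted_gen n y = const_fps (\<Prod>r<n. linear_fps (- of_nat r - 1/2)) * (\<Prod>i\<in>{1..n}. geometric_fps (y i + const (1/2)))"

text \<open>At $y_i = x_i - i$ the product is $H^*(u - \frac12)$.\<close>

definition shifted_H :: "nat \<Rightarrow> cpoly fps" where
  "shifted_H n = shifted_gen n (\<lambda>i. var i - of_nat i)"

lemma subst_shifted_gen: "subst_fps \<sigma> (shifted_gen n y) = shifted_gen n (\<lambda>i. subst_poly \<sigma> (y i))"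
  by (simp add: shifted_gen_def subst_fps_mult subst_fps_prod subst_fps_geometric subst_poly_add)

lemma shifted_gen_nth_0 [simp]: "fps_nth (shifted_gen n y) 0 = 1"
  by (simp add: shifted_gen_def geometric_fps_def prod_nth_0)

lemma shifted_gen_cong: "(\<And>i. i \<in> {1..n} \<Longrightarrow> y i = y' i) \<Longrightarrow> shifted_gen n y = shifted_gen n y'"
  by (simp add: shifted_gen_def)

text \<open>Permuting the variables permutes the factors of the product.\<close>

lemma shifted_gen_nth_sympoly: "fps_nth (shifted_gen n var) m \<in> sympoly n"
proof -
  have "poly_vars (fps_nth (shifted_gen n var) m) \<subseteq> {1..n}"
    unfolding shifted_gen_def
  proof (intro poly_vars_fps_mult poly_vars_fps_prod)
    show "poly_vars (fps_nth (geometric_fps (var i + const (1/2))) m) \<subseteq> {1..n}" if "i \<in> {1..n}" for i m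
      using that by (simp add: geometric_fps_def poly_vars_power poly_vars_add)
  qed simp
  moreover have "subst_poly (\<lambda>i. var (\<pi> i)) (fps_nth (shifted_gen n var) m) = fps_nth (shifted_gen n var) m"
    if "\<pi> permutes {1..n}" for \<pi>
  proof -
    have "shifted_gen n (\<lambda>i. var (\<pi> i)) = shifted_gen n var"
      using prod.permute[OF that, of "\<lambda>i. geometric_fps (var i + const (1/2))"]
      by (simp add: shifted_gen_def o_def)
    then show ?thesis unfolding subst_fps_nth[symmetric] subst_shifted_gen by simp
  qed
  ultimately show ?thesis by (simp add: sympoly_def)
qed

text \<open>Stability holds because at $x_{n+1} = 0$ the numerator and the denominator of the last factor
coincide.\<close>

lemma shifted_H_nth_Lambda_star: "(\<lambda>n. fps_nth (shifted_H n) m) \<in> Lambda_star"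
proof -
  have "fps_nth (shifted_H n) m \<in> Lambda_star_n n" for n
  proof -
    have "fps_nth (shifted_H n) m = subst_poly (\<lambda>j. var j - of_nat j) (fps_nth (shifted_gen n var) m)"
      unfolding subst_fps_nth[symmetric] subst_shifted_gen shifted_H_def by simp
    then show ?thesis unfolding Lambda_star_n_def using shifted_gen_nth_sympoly by blast
  qed
  moreover have "subst_poly (var(Suc n := 0)) (fps_nth (shifted_H (Suc n)) m) = fps_nth (shifted_H n) m" for n
  proof -
    let ?y = "\<lambda>i. subst_poly (var(Suc n := 0)) (var i - of_nat i)"
    let ?geo = "\<lambda>i. geometric_fps (?y i + const (1/2))"
    have y: "?y i = var i - of_nat i" if "i \<in> {1..n}" for i
      using that by (simp add: subst_poly_diff)
    have "?y (Suc n) + const (1/2) = const (- of_nat n - 1/2)"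
    proof -
      have "?y (Suc n) + const (1/2) = const (- of_nat (Suc n)) + const (1/2)"
        by (simp only: subst_poly_diff subst_poly_var subst_poly_of_nat const_minus const_of_nat fun_upd_same diff_0)
      also have "\<dots> = const (- of_nat n - 1/2)"
        unfolding const_add[symmetric] by (intro arg_cong[where f = const]) simp
      finally show ?thesis .
    qed
    then have last: "const_fps (linear_fps (- of_nat n - 1/2)) * ?geo (Suc n) = 1"
      unfolding const_fps_linear by (simp add: linear_times_geometric)
    have "shifted_gen (Suc n) ?y = (const_fps (linear_fps (- of_nat n - 1/2)) * ?geo (Suc n)) *
        (const_fps (\<Prod>r<n. linear_fps (- of_nat r - 1/2)) * (\<Prod>i\<in>{1..n}. ?geo i))"
      unfolding shifted_gen_def prod.lessThan_Suc const_fps_mult by (simp add: mult_ac)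
    also have "\<dots> = shifted_gen n ?y" unfolding last by (simp add: shifted_gen_def)
    also have "\<dots> = shifted_H n" unfolding shifted_H_def using y by (rule shifted_gen_cong)
    finally show ?thesis unfolding subst_fps_nth[symmetric] shifted_H_def subst_shifted_gen by simp
  qed
  moreover have "degree_le m (fps_nth (shifted_H n) m)" for n
    unfolding shifted_H_def shifted_gen_def
  proof (intro degree_le_fps_mult degree_le_fps_prod)
    fix i m
    have "var i - of_nat i + const (1/2) = var i + const (1/2 - of_nat i)"
      by (simp add: const_diff const_of_nat)
    then have "degree_le 1 (var i - of_nat i + const (1/2))"
      using degree_le_add[OF degree_le_var degree_le_const] by metis
    then show "degree_le m (fps_nth (geometric_fps (var i - of_nat i + const (1/2))) m)"
      by (simp add: geometric_fps_def degree_le_power)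
  qed (simp add: degree_le_const)
  ultimately show ?thesis unfolding Lambda_star_def by blast
qed

lemma sympoly_add: "f \<in> sympoly n \<Longrightarrow> g \<in> sympoly n \<Longrightarrow> f + g \<in> sympoly n"
  and sympoly_mult: "f \<in> sympoly n \<Longrightarrow> g \<in> sympoly n \<Longrightarrow> f * g \<in> sympoly n"
  and sympoly_const: "const c \<in> sympoly n"
  by (simp_all add: sympoly_def poly_vars_add poly_vars_mult subst_poly_add subst_poly_mult)

lemma Lambda_star_n_closed:
  shows "f \<in> Lambda_star_n n \<Longrightarrow> g \<in> Lambda_star_n n \<Longrightarrow> f + g \<in> Lambda_star_n n"
    and "f \<in> Lambda_star_n n \<Longrightarrow> g \<in> Lambda_star_n n \<Longrightarrow> f * g \<in> Lambda_star_n n"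
    and "const c \<in> Lambda_star_n n"
proof -
  show "f + g \<in> Lambda_star_n n" if "f \<in> Lambda_star_n n" "g \<in> Lambda_star_n n"
    using that unfolding Lambda_star_n_def by (auto simp: sympoly_add simp flip: subst_poly_add)
  show "f * g \<in> Lambda_star_n n" if "f \<in> Lambda_star_n n" "g \<in> Lambda_star_n n"
    using that unfolding Lambda_star_n_def by (auto simp: sympoly_mult simp flip: subst_poly_mult)
  show "const c \<in> Lambda_star_n n"
    unfolding Lambda_star_n_def by (rule image_eqI[of _ _ "const c"]) (simp_all add: sympoly_const)
qed

lemma Lambda_star_const: "(\<lambda>n. const c) \<in> Lambda_star"
  unfolding Lambda_star_def using degree_le_const[of 0 c] by (auto simp: Lambda_star_n_closed)

lemma Lambda_star_add: "f \<in> Lambda_star \<Longrightarrow> g \<in> Lambda_star \<Longrightarrow> (\<lambda>n. f n + g n) \<in> Lambda_star"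
proof -
  assume f: "f \<in> Lambda_star" and g: "g \<in> Lambda_star"
  obtain D D' where "\<And>n. degree_le D (f n)" "\<And>n. degree_le D' (g n)"
    using f g unfolding Lambda_star_def by blast
  then have "degree_le (max D D') (f n + g n)" for n
    by (intro degree_le_add degree_le_mono[of D _ "max D D'"] degree_le_mono[of D' _ "max D D'"]) auto
  then show ?thesis using f g unfolding Lambda_star_def
    by (auto simp: Lambda_star_n_closed subst_poly_add)
qed

lemma Lambda_star_mult: "f \<in> Lambda_star \<Longrightarrow> g \<in> Lambda_star \<Longrightarrow> (\<lambda>n. f n * g n) \<in> Lambda_star"
proof -
  assume f: "f \<in> Lambda_star" and g: "g \<in> Lambda_star"
  obtain D D' where "\<And>n. degree_le D (f n)" "\<And>n. degree_le D' (g n)"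
    using f g unfolding Lambda_star_def by blast
  then have "degree_le (D + D') (f n * g n)" for n by (intro degree_le_mult)
  then show ?thesis using f g unfolding Lambda_star_def
    by (auto simp: Lambda_star_n_closed subst_poly_mult)
qed

lemma Lambda_star_sum: "(\<And>x. x \<in> S \<Longrightarrow> F x \<in> Lambda_star) \<Longrightarrow> (\<lambda>n. \<Sum>x\<in>S. F x n) \<in> Lambda_star"
  by (induction S rule: infinite_finite_induct) (use Lambda_star_const[of 0] in \<open>simp_all add: Lambda_star_add\<close>)

lemma Lambda_star_prod: "(\<And>x. x \<in> S \<Longrightarrow> F x \<in> Lambda_star) \<Longrightarrow> (\<lambda>n. \<Prod>x\<in>S. F x n) \<in> Lambda_star"
  by (induction S rule: infinite_finite_induct) (use Lambda_star_const[of 1] in \<open>simp_all add: Lambda_star_mult\<close>)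

lemma Lambda_star_fdet:
  assumes "\<And>i j. F i j \<in> Lambda_star"
  shows "(\<lambda>n. fdet N (\<lambda>i j. F i j n)) \<in> Lambda_star"
  unfolding fdet_expand const_of_int[symmetric]
  by (intro Lambda_star_sum Lambda_star_mult Lambda_star_prod Lambda_star_const assms)


section \<open>Jacobi--Trudi determinants\<close>

text \<open>The entries are the coefficients of $u^{-1}$ in $u^k b_k\, u^i F$, where $b_k$ and $F$ are series in
$u^{-1}$ and the columns $i$ are numbered from $0$.\<close>

definition jt_row :: "(int \<Rightarrow> complex fps) \<Rightarrow> cpoly fps \<Rightarrow> int \<Rightarrow> nat \<Rightarrow> cpoly" where
  "jt_row b F k i = coeff_at (const_fps (b k) * F) (k + int i + 1)"

definition jacobi_trudi :: "(int \<Rightarrow> complex fps) \<Rightarrow> cpoly fps \<Rightarrow> nat list \<Rightarrow> nat \<Rightarrow> cpoly" where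
  "jacobi_trudi b F \<mu> N = fdet N (\<lambda>j. jt_row b F (int (row \<mu> (j + 1)) - int (j + 1)))"

lemma jt_row_neg:
  assumes "fps_nth (b (- int q - 1)) 0 = 1" "fps_nth F 0 = 1" "i \<le> q"
  shows "jt_row b F (- int q - 1) i = (if i = q then 1 else 0)"
  using assms by (auto simp: jt_row_def coeff_at_def)

text \<open>Beyond the length of the diagram the last row is the last unit vector.\<close>

lemma jacobi_trudi_stable:
  assumes "\<And>k. fps_nth (b k) 0 = 1" "fps_nth F 0 = 1" "length \<mu> \<le> N"
  shows "jacobi_trudi b F \<mu> N = jacobi_trudi b F \<mu> (length \<mu>)"
  using assms(3)
proof (induction N rule: dec_induct)
  case (step N)
  have "row \<mu> (N + 1) = 0" using step(1) by (simp add: row_def)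
  then have k: "int (row \<mu> (N + 1)) - int (N + 1) = - int N - 1" by simp
  have "jacobi_trudi b F \<mu> (Suc N) = (-1) ^ (N + N) *
      fdet N (\<lambda>i j. jt_row b F (int (row \<mu> (i + 1)) - int (i + 1)) (if j < N then j else Suc j))"
    unfolding jacobi_trudi_def
    by (rule fdet_last_row_unit[OF le_refl]) (simp only: k jt_row_neg[of b N, OF assms(1,2)])
  also have "\<dots> = jacobi_trudi b F \<mu> N"
    unfolding jacobi_trudi_def by (simp, intro fdet_cong) simp
  finally show ?case using step.IH by simp
qed simp

lemma hsym_eq_coeff_at: "hsym k = coeff_at H_series k"
  by (simp add: hsym_def coeff_at_def)

lemma schur_eq_jacobi_trudi: "schur \<nu> = jacobi_trudi (\<lambda>_. 1) H_series \<nu> (length \<nu>)"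
  unfolding schur_def jacobi_trudi_def fdet_def jt_row_def hsym_eq_coeff_at
  by (intro arg_cong[where f = det] eq_matI) (simp_all add: algebra_simps)

lemma H_series_nth_0 [simp]: "fps_nth H_series 0 = 1"
  by (simp add: H_series_def fps_compose_nth)


section \<open>Shifted Schur functions as Jacobi--Trudi determinants\<close>

text \<open>The pole of the $i$-th factor of \<open>shifted_H\<close>.\<close>

definition node :: "nat \<Rightarrow> cpoly" where
  "node i = var i - of_nat i + const (1/2)"

lemma shifted_H_eq: "shifted_H n = const_fps (\<Prod>r<n. linear_fps (- of_nat r - 1/2)) * (\<Prod>i\<in>{1..n}. geometric_fps (node i))"
  by (simp add: shifted_H_def shifted_gen_def node_def)

text \<open>The second determinant has the coefficients of $\prod_{l \ne k} (1 - z_l u^{-1})$ as its $k$-th column, where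
$z_l$ is the pole of the $l$-th factor. Multiplying row $j$ of the Jacobi--Trudi matrix by this column
cancels all poles but $z_k$, and clears the denominator of the falling factorial against the numerator
of the generating series. What is left evaluates a product of linear factors at $z_k$, and the value is the entry of the
alternant. The second determinant does not depend on $\mu$, so it equals the alternant of the empty
diagram.\<close>

lemma alternant_eq_jacobi_trudi:
  "alternant \<mu> n = jacobi_trudi falling_fps (shifted_H n) \<mu> n *
     fdet n (\<lambda>i k. fps_nth (\<Prod>l\<in>{1..n} - {k + 1}. linear_fps (node l)) (n - 1 - i))"
proof -
  define E where "E = (\<lambda>k. \<Prod>l\<in>{1..n} - {k + 1}. linear_fps (node l))"
  define N where "N = (\<lambda>j. row \<mu> (j + 1) + n - (j + 1))"
  have E_beyond: "fps_nth (E k) s = 0" if "k < n" "n \<le> s" for k s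
    unfolding E_def using that by (intro prod_linear_nth_beyond) auto
  have entry: "(\<Sum>i<n. jt_row falling_fps (shifted_H n) (int (row \<mu> (j + 1)) - int (j + 1)) i * fps_nth (E k) (n - 1 - i)) =
      falling (var (k + 1) + of_nat (n - (k + 1))) (N j)" if j: "j < n" and k: "k < n" for j k
  proof -
    \<comment> \<open>The subtraction in \<open>N\<close> does not truncate because \<open>j < n\<close>.\<close>
    have kj: "int (row \<mu> (j + 1)) - int (j + 1) = int (N j) - int n"
      using j by (simp add: N_def of_nat_diff)
    define F where "F = const_fps (falling_fps (int (N j) - int n)) * shifted_H n"
    have "(\<Sum>i<n. jt_row falling_fps (shifted_H n) (int (row \<mu> (j + 1)) - int (j + 1)) i * fps_nth (E k) (n - 1 - i)) =
        (\<Sum>i<n. coeff_at F (int (N j) - int n + int i + 1) * fps_nth (E k) (n - 1 - i))"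
      by (simp only: jt_row_def kj F_def)
    also have "\<dots> = (\<Sum>s<n. fps_nth (E k) s * coeff_at F (int (N j) - int s))"
      by (rule sum.reindex_bij_witness[of _ "\<lambda>s. n - 1 - s" "\<lambda>i. n - 1 - i"])
        (auto simp: mult.commute of_nat_diff algebra_simps)
    also have "\<dots> = coeff_at (E k * F) (int (N j))"
      using E_beyond[OF k] by (rule coeff_at_convolution)
    also have "\<dots> = fps_nth (E k * F) (N j)" by (simp add: coeff_at_def)
    also have "E k * F = const_fps (falling_fps (int (N j) - int n) * (\<Prod>r<n. linear_fps (- of_nat r - 1/2))) *
        (E k * (\<Prod>i\<in>{1..n}. geometric_fps (node i)))"
      unfolding F_def shifted_H_eq const_fps_mult by (simp only: mult_ac)
    also have "E k * (\<Prod>i\<in>{1..n}. geometric_fps (node i)) = geometric_fps (node (k + 1))"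
    proof -
      have "(\<Prod>i\<in>{1..n}. geometric_fps (node i)) = geometric_fps (node (k + 1)) * (\<Prod>i\<in>{1..n} - {k + 1}. geometric_fps (node i))"
        using k by (intro prod.remove) auto
      moreover have "E k * (\<Prod>i\<in>{1..n} - {k + 1}. geometric_fps (node i)) = 1"
        unfolding E_def prod.distrib[symmetric] by (simp add: linear_times_geometric)
      ultimately show ?thesis by (simp add: mult.left_commute)
    qed
    also have "const_fps (falling_fps (int (N j) - int n) * (\<Prod>r<n. linear_fps (- of_nat r - 1/2))) =
        (\<Prod>r<N j. linear_fps (const (of_nat r - of_nat n + 1/2)))"
      unfolding falling_fps_clear_denominator const_fps_prod const_fps_linear ..
    also have "fps_nth (\<dots> * geometric_fps (node (k + 1))) (N j) =
        (\<Prod>r<N j. node (k + 1) - const (of_nat r - of_nat n + 1/2))"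
      using prod_linear_times_geometric_nth[of "N j" "N j" "\<lambda>r. const (of_nat r - of_nat n + 1/2)" "node (k + 1)"]
      by simp
    also have "\<dots> = falling (var (k + 1) + of_nat (n - (k + 1))) (N j)"
      unfolding falling_def using k
      by (intro prod.cong refl) (simp add: node_def const_add const_diff const_of_nat of_nat_diff)
    finally show ?thesis .
  qed
  have "alternant \<mu> n = fdet n (\<lambda>i j. falling (var (i + 1) + of_nat (n - (i + 1))) (N j))"
    unfolding alternant_def fdet_def N_def ..
  also have "\<dots> = fdet n (\<lambda>j k. falling (var (k + 1) + of_nat (n - (k + 1))) (N j))"
    by (rule fdet_transpose)
  also have "\<dots> = jacobi_trudi falling_fps (shifted_H n) \<mu> n * fdet n (\<lambda>i k. fps_nth (E k) (n - 1 - i))"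
    unfolding jacobi_trudi_def fdet_mult by (intro fdet_cong) (simp only: entry)
  finally show ?thesis unfolding E_def .
qed

lemma shifted_H_nth_0 [simp]: "fps_nth (shifted_H n) 0 = 1"
  by (simp add: shifted_H_def)

lemma alternant_quotient:
  assumes "length \<mu> \<le> n"
  shows "jacobi_trudi falling_fps (shifted_H n) \<mu> (length \<mu>) * alternant [] n = alternant \<mu> n"
proof -
  have "jacobi_trudi falling_fps (shifted_H n) [] n = jacobi_trudi falling_fps (shifted_H n) [] 0"
    using jacobi_trudi_stable[of falling_fps "shifted_H n" "[]" n] by simp
  then have "jacobi_trudi falling_fps (shifted_H n) [] n = 1"
    by (simp add: jacobi_trudi_def fdet_expand)
  moreover have "jacobi_trudi falling_fps (shifted_H n) \<mu> (length \<mu>) = jacobi_trudi falling_fps (shifted_H n) \<mu> n"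
    using assms by (intro jacobi_trudi_stable[symmetric]) simp_all
  ultimately show ?thesis using alternant_eq_jacobi_trudi[of \<mu> n] alternant_eq_jacobi_trudi[of "[]" n] by simp
qed

text \<open>At $x = 0$ the matrix is triangular with factorials on the diagonal.\<close>

lemma alternant_empty_nonzero: "alternant [] n \<noteq> 0"
proof
  assume zero: "alternant [] n = 0"
  have sub: "subst_poly (\<lambda>_. 0) (falling (var i + of_nat a) m) = falling (of_nat a) m" for i a m
    by (simp add: falling_def subst_poly_prod subst_poly_diff subst_poly_add)
  have "alternant [] n = fdet n (\<lambda>i j. falling (var (i + 1) + of_nat (n - (i + 1))) (n - (j + 1)))"
    unfolding alternant_def fdet_def by (simp add: row_def)
  then have "subst_poly (\<lambda>_. 0) (alternant [] n) = fdet n (\<lambda>i j. falling (of_nat (n - (i + 1)) :: cpoly) (n - (j + 1)))"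
    by (simp only: subst_poly_fdet sub)
  also have "\<dots> = (\<Prod>i<n. falling (of_nat (n - (i + 1))) (n - (i + 1)))"
  proof (rule fdet_upper_triangular)
    fix i j assume "j < i" "i < n"
    then show "falling (of_nat (n - (i + 1)) :: cpoly) (n - (j + 1)) = 0"
      unfolding falling_def by (intro prod_zero bexI[of _ "n - (i + 1)"]) auto
  qed
  finally have "(\<Prod>i<n. falling (of_nat (n - (i + 1)) :: cpoly) (n - (i + 1))) = 0" by (simp add: zero)
  moreover have "falling (of_nat a :: cpoly) a \<noteq> 0" for a
    by (auto simp: falling_def)
  ultimately show False unfolding prod_zero_iff[OF finite_lessThan] by blast
qed

lemma coeff_at_Lambda_star: "(\<lambda>n. coeff_at (const_fps B * shifted_H n) m) \<in> Lambda_star"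
proof (cases "m < 0")
  case True
  then show ?thesis using Lambda_star_const[of 0] by (simp add: coeff_at_def)
next
  case False
  then show ?thesis
    by (simp add: coeff_at_def fps_mult_nth)
      (intro Lambda_star_sum Lambda_star_mult Lambda_star_const shifted_H_nth_Lambda_star)
qed

lemma jacobi_trudi_Lambda_star: "(\<lambda>n. jacobi_trudi b (shifted_H n) \<mu> N) \<in> Lambda_star"
  unfolding jacobi_trudi_def jt_row_def
  by (rule Lambda_star_fdet[where F = "\<lambda>j i n. coeff_at (const_fps (b (int (row \<mu> (j + 1)) - int (j + 1))) * shifted_H n)
        (int (row \<mu> (j + 1)) - int (j + 1) + int i + 1)"]) (rule coeff_at_Lambda_star)

text \<open>Uniqueness in many variables is cancellation in an integral domain; stability carries it down to fewer
variables.\<close>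

lemma shifted_schur_eq: "shifted_schur \<mu> = (\<lambda>n. jacobi_trudi falling_fps (shifted_H n) \<mu> (length \<mu>))"
  unfolding shifted_schur_def
proof (rule the_equality)
  show "(\<lambda>n. jacobi_trudi falling_fps (shifted_H n) \<mu> (length \<mu>)) \<in> Lambda_star \<and>
      (\<forall>n\<ge>length \<mu>. jacobi_trudi falling_fps (shifted_H n) \<mu> (length \<mu>) * alternant [] n = alternant \<mu> n)"
    using jacobi_trudi_Lambda_star alternant_quotient by blast
next
  fix f assume f: "f \<in> Lambda_star \<and> (\<forall>n\<ge>length \<mu>. f n * alternant [] n = alternant \<mu> n)"
  define g where "g = (\<lambda>n. jacobi_trudi falling_fps (shifted_H n) \<mu> (length \<mu>))"
  have g: "g \<in> Lambda_star" unfolding g_def by (rule jacobi_trudi_Lambda_star)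
  have large: "f n = g n" if "length \<mu> \<le> n" for n
  proof -
    have "f n * alternant [] n = g n * alternant [] n"
      using f alternant_quotient[OF that] that by (simp add: g_def)
    then show ?thesis using alternant_empty_nonzero by simp
  qed
  have "f n = g n" if "n \<le> length \<mu>" for n
    using that
  proof (induction n rule: inc_induct)
    case base
    show ?case by (rule large) simp
  next
    case (step n)
    have "f n = subst_poly (var(Suc n := 0)) (f (Suc n))" "g n = subst_poly (var(Suc n := 0)) (g (Suc n))"
      using f g by (auto simp: Lambda_star_def)
    then show ?case using step.IH by simp
  qed
  with large have "f n = g n" for n by (cases "length \<mu> \<le> n") auto
  then show "f = (\<lambda>n. jacobi_trudi falling_fps (shifted_H n) \<mu> (length \<mu>))" unfolding g_def by blast
qed


section \<open>Transport to symmetric functions\<close>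

text \<open>The one-row case of \<open>shifted_schur_eq\<close>.\<close>

lemma hstar_eq: "hstar (Suc k) n = (\<Sum>l\<le>k. const (falling_coeff k l) * fps_nth (shifted_H n) (Suc l))"
proof -
  have "hstar (Suc k) n = jt_row falling_fps (shifted_H n) (int k) 0"
    unfolding hstar_def shifted_schur_eq jacobi_trudi_def by (subst fdet_upper_triangular) (simp_all add: row_def)
  also have "\<dots> = fps_nth (const_fps (falling_fps (int k)) * shifted_H n) (Suc k)"
    by (simp add: jt_row_def coeff_at_def nat_add_distrib)
  also have "\<dots> = (\<Sum>s\<in>{0..k}. const (fps_nth (falling_fps (int k)) s) * fps_nth (shifted_H n) (Suc k - s))"
    by (simp add: fps_mult_nth falling_fps_nth_beyond)
  also have "\<dots> = (\<Sum>l\<le>k. const (falling_coeff k l) * fps_nth (shifted_H n) (Suc l))"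
    by (rule sum.reindex_bij_witness[of _ "\<lambda>l. k - l" "\<lambda>s. k - s"]) (auto simp: falling_coeff_def Suc_diff_le)
  finally show ?thesis .
qed

lemma inv_u_plus_half_low_nths: "fps_nth inv_u_plus_half 0 = 0" "fps_nth inv_u_plus_half 1 = 1"
  using arg_cong[OF inv_u_plus_half, of "\<lambda>F. fps_nth F 0"] arg_cong[OF inv_u_plus_half, of "\<lambda>F. fps_nth F 1"]
  by simp_all

text \<open>This is the identity between $H^*(u)$ and \<open>shifted_H\<close> at $u + \frac12$, coefficient by coefficient.\<close>

lemma Hstar_coeff_eq:
  "Hstar_coeff m n = (\<Sum>l\<le>m. const (fps_nth (inv_u_plus_half ^ l) m) * fps_nth (shifted_H n) l)"
proof -
  have "(\<Sum>k = 1..m. const (fps_nth (inv_falling k) m) * hstar k n) =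
      (\<Sum>k<m. const (fps_nth (inv_falling (Suc k)) m) * (\<Sum>l<m. const (falling_coeff k l) * fps_nth (shifted_H n) (Suc l)))"
  proof (rule sum.reindex_bij_witness[of _ Suc "\<lambda>k. k - 1"])
    fix k assume "k \<in> {1..m}"
    then obtain k' where k: "k = Suc k'" "k' < m" by (cases k) auto
    have "hstar k n = (\<Sum>l<m. const (falling_coeff k' l) * fps_nth (shifted_H n) (Suc l))"
      unfolding k hstar_eq using k by (intro sum.mono_neutral_left) (auto simp: falling_coeff_def)
    then show "const (fps_nth (inv_falling (Suc (k - 1))) m) * (\<Sum>l<m. const (falling_coeff (k - 1) l) * fps_nth (shifted_H n) (Suc l)) =
        const (fps_nth (inv_falling k) m) * hstar k n" by (simp add: k)
  qed auto
  also have "\<dots> = (\<Sum>l<m. (\<Sum>k<m. const (fps_nth (inv_falling (Suc k)) m) * const (falling_coeff k l)) * fps_nth (shifted_H n) (Suc l))"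
    by (rule sum_reassociate)
  also have "\<dots> = (\<Sum>l<m. const (\<Sum>k<m. falling_coeff k l * fps_nth (inv_falling (Suc k)) m) * fps_nth (shifted_H n) (Suc l))"
    by (simp add: const_sum const_mult mult.commute)
  also have "\<dots> = (\<Sum>l<m. const (fps_nth (inv_u_plus_half ^ Suc l) m) * fps_nth (shifted_H n) (Suc l))"
    by (simp only: inv_u_plus_half_power_expansion[OF le_refl])
  also have "(if m = 0 then 1 else 0) + \<dots> = (\<Sum>l\<in>insert 0 (Suc ` {..<m}). const (fps_nth (inv_u_plus_half ^ l) m) * fps_nth (shifted_H n) l)"
    by (subst sum.insert) (auto simp: sum.reindex)
  also have "insert 0 (Suc ` {..<m}) = {..m}" by (auto simp: image_iff less_Suc_eq_0_disj Bex_def) (metis Suc_pred gr0I Suc_le_eq)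
  finally show ?thesis by (simp add: Hstar_coeff_def)
qed

lemma H_shifted_nth: "fps_nth H_shifted m = (\<Sum>l\<le>m. const (fps_nth (inv_u_plus_half ^ l) m) * fps_nth H_series l)"
  unfolding H_shifted_def fps_compose_nth const_fps_def[symmetric] const_fps_power[symmetric]
  by (simp add: mult.commute atLeast0AtMost)

lemma algebra_iso_hom:
  assumes "algebra_iso \<phi>"
  shows algebra_iso_const: "\<phi> (\<lambda>n. const c) = const c"
    and algebra_iso_add: "f \<in> Lambda_star \<Longrightarrow> g \<in> Lambda_star \<Longrightarrow> \<phi> (\<lambda>n. f n + g n) = \<phi> f + \<phi> g"
    and algebra_iso_mult: "f \<in> Lambda_star \<Longrightarrow> g \<in> Lambda_star \<Longrightarrow> \<phi> (\<lambda>n. f n * g n) = \<phi> f * \<phi> g"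
proof -
  have one: "(\<lambda>n. 1) \<in> Lambda_star" using Lambda_star_const[of 1] by simp
  have "\<phi> (\<lambda>n. const a * f n) = const a * \<phi> f" if "f \<in> Lambda_star" for a f
    using assms that unfolding algebra_iso_def by blast
  from this[OF one] have "\<phi> (\<lambda>n. const c * 1) = const c * \<phi> (\<lambda>n. 1)" .
  moreover have "\<phi> (\<lambda>n. 1) = 1" using assms unfolding algebra_iso_def by blast
  ultimately show "\<phi> (\<lambda>n. const c) = const c" by simp
qed (use assms in \<open>auto simp: algebra_iso_def\<close>)

lemma algebra_iso_sum:
  assumes "algebra_iso \<phi>" "\<And>x. x \<in> S \<Longrightarrow> F x \<in> Lambda_star"
  shows "\<phi> (\<lambda>n. \<Sum>x\<in>S. F x n) = (\<Sum>x\<in>S. \<phi> (F x))"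
  using assms(2)
proof (induction S rule: infinite_finite_induct)
  case (insert x S)
  then show ?case by (simp add: algebra_iso_add[OF assms(1)] Lambda_star_sum)
qed (use algebra_iso_const[OF assms(1), of 0] in simp_all)

lemma algebra_iso_prod:
  assumes "algebra_iso \<phi>" "\<And>x. x \<in> S \<Longrightarrow> F x \<in> Lambda_star"
  shows "\<phi> (\<lambda>n. \<Prod>x\<in>S. F x n) = (\<Prod>x\<in>S. \<phi> (F x))"
  using assms(2)
proof (induction S rule: infinite_finite_induct)
  case (insert x S)
  then show ?case by (simp add: algebra_iso_mult[OF assms(1)] Lambda_star_prod)
qed (use algebra_iso_const[OF assms(1), of 1] in simp_all)

lemma algebra_iso_fdet:
  assumes "algebra_iso \<phi>" "\<And>i j. F i j \<in> Lambda_star"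
  shows "\<phi> (\<lambda>n. fdet N (\<lambda>i j. F i j n)) = fdet N (\<lambda>i j. \<phi> (F i j))"
  unfolding fdet_expand const_of_int[symmetric]
  by (simp add: algebra_iso_sum[OF assms(1)] algebra_iso_mult[OF assms(1)] algebra_iso_prod[OF assms(1)]
      algebra_iso_const[OF assms(1)] Lambda_star_mult Lambda_star_const Lambda_star_prod assms(2))

text \<open>The coefficients of $H^*(u)$ and of $H(u + \frac12)$ are the same unitriangular combinations of those of
\<open>shifted_H\<close> and of $H(u)$, respectively. So induction on $m$ transfers the hypothesis on $\varphi$.\<close>

lemma frobenius_schur_iso_shifted_H:
  assumes "frobenius_schur_iso \<phi>"
  shows "\<phi> (\<lambda>n. fps_nth (shifted_H n) m) = fps_nth H_series m"
proof (induction m rule: less_induct)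
  case (less m)
  have iso: "algebra_iso \<phi>" and H: "\<phi> (Hstar_coeff m) = fps_nth H_shifted m"
    using assms by (auto simp: frobenius_schur_iso_def)
  let ?c = "\<lambda>l. const (fps_nth (inv_u_plus_half ^ l) m)"
  have top: "?c m = 1"
    using startsby_zero_power_nth_same[of inv_u_plus_half m] by (simp add: inv_u_plus_half_low_nths[simplified])
  have "(\<Sum>l\<le>m. ?c l * \<phi> (\<lambda>n. fps_nth (shifted_H n) l)) = \<phi> (\<lambda>n. \<Sum>l\<le>m. ?c l * fps_nth (shifted_H n) l)"
    by (simp add: algebra_iso_sum[OF iso] algebra_iso_mult[OF iso] algebra_iso_const[OF iso]
        Lambda_star_mult Lambda_star_const shifted_H_nth_Lambda_star)
  also have "(\<lambda>n. \<Sum>l\<le>m. ?c l * fps_nth (shifted_H n) l) = Hstar_coeff m"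
    by (rule ext) (simp add: Hstar_coeff_eq)
  also have "\<phi> (Hstar_coeff m) = (\<Sum>l\<le>m. ?c l * fps_nth H_series l)" by (simp add: H H_shifted_nth)
  finally have "(\<Sum>l<m. ?c l * \<phi> (\<lambda>n. fps_nth (shifted_H n) l)) + \<phi> (\<lambda>n. fps_nth (shifted_H n) m) =
      (\<Sum>l<m. ?c l * fps_nth H_series l) + fps_nth H_series m"
    using top by (simp add: lessThan_Suc_atMost[symmetric])
  then show ?case using less.IH by simp
qed

lemma frobenius_schur_eq:
  assumes "frobenius_schur_iso \<phi>"
  shows "frobenius_schur \<phi> \<mu> = jacobi_trudi falling_fps H_series \<mu> (length \<mu>)"
proof -
  have iso: "algebra_iso \<phi>" using assms by (simp add: frobenius_schur_iso_def)
  have coeff: "\<phi> (\<lambda>n. coeff_at (const_fps B * shifted_H n) m) = coeff_at (const_fps B * H_series) m" for B m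
  proof (cases "m < 0")
    case True
    then show ?thesis using algebra_iso_const[OF iso, of 0] by (simp add: coeff_at_def)
  next
    case False
    then show ?thesis
      by (simp add: coeff_at_def fps_mult_nth algebra_iso_sum[OF iso] algebra_iso_mult[OF iso] algebra_iso_const[OF iso]
          Lambda_star_mult Lambda_star_const shifted_H_nth_Lambda_star frobenius_schur_iso_shifted_H[OF assms])
  qed
  show ?thesis
    unfolding frobenius_schur_def shifted_schur_eq jacobi_trudi_def jt_row_def
    by (subst algebra_iso_fdet[OF iso, where F = "\<lambda>j i n. coeff_at (const_fps (falling_fps (int (row \<mu> (j + 1)) - int (j + 1))) * shifted_H n)
        (int (row \<mu> (j + 1)) - int (j + 1) + int i + 1)"]) (rule coeff_at_Lambda_star, simp only: coeff)
qed


section \<open>The expansion of Frobenius--Schur functions\<close>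

text \<open>If $b_i > a_i$, the rows from $i$ on vanish in the columns up to $i$. Then every permutation meets a
zero entry, since these $d - i$ rows cannot be matched with the remaining $d - i - 1$ columns.\<close>

lemma hook_det_nonzero:
  assumes nz: "fdet d (\<lambda>i j. hook_coeff (a i) (b j)) \<noteq> 0"
    and a: "\<And>i j. i < j \<Longrightarrow> j < d \<Longrightarrow> a j < a i" and b: "\<And>i j. i < j \<Longrightarrow> j < d \<Longrightarrow> b j < b i"
    and i: "i < d"
  shows "b i \<le> a i"
proof (rule ccontr)
  assume less: "\<not> b i \<le> a i"
  have zero: "hook_coeff (a k) (b l) = 0" if "i \<le> k" "k < d" "l \<le> i" for k l
  proof -
    have "a k \<le> a i" using a[of i k] that by (cases "k = i") auto
    moreover have "b i \<le> b l" using b[of l i] that i by (cases "l = i") auto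
    ultimately show ?thesis using less by (simp add: hook_coeff_def)
  qed
  have vanish: "(\<Prod>k<d. hook_coeff (a k) (b (\<pi> k))) = 0" if p: "\<pi> permutes {..<d}" for \<pi>
  proof -
    have "\<exists>k\<in>{i..<d}. \<pi> k \<le> i"
    proof (rule ccontr)
      assume "\<not> (\<exists>k\<in>{i..<d}. \<pi> k \<le> i)"
      then have "\<pi> ` {i..<d} \<subseteq> {Suc i..<d}"
        using permutes_in_image[OF p] by (auto simp: not_le)
      then have "card (\<pi> ` {i..<d}) \<le> card {Suc i..<d}" by (intro card_mono) auto
      then show False using i card_image[OF permutes_inj_on[OF p], of "{i..<d}"] by simp
    qed
    then obtain k where "i \<le> k" "k < d" "\<pi> k \<le> i" by auto
    then show ?thesis using zero[of k "\<pi> k"] by (intro prod_zero) auto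
  qed
  have "fdet d (\<lambda>i j. hook_coeff (a i) (b j)) = 0"
    unfolding fdet_expand
  proof (rule sum.neutral, rule ballI)
    fix \<pi> assume "\<pi> \<in> {\<pi>. \<pi> permutes {..<d}}"
    then show "of_int (sign \<pi>) * (\<Prod>k<d. hook_coeff (a k) (b (\<pi> k))) = 0"
      by (simp only: vanish mem_Collect_eq mult_zero_right)
  qed
  with nz show False by simp
qed

definition frobenius_coeff :: "nat list \<Rightarrow> nat list \<Rightarrow> complex" where
  "frobenius_coeff \<mu> \<nu> =
     fdet (diag_squares \<mu>) (\<lambda>i j. hook_coeff (frob_p \<mu> (i + 1)) (frob_p \<nu> (j + 1))) *
     fdet (diag_squares \<mu>) (\<lambda>i j. hook_coeff (frob_q \<mu> (i + 1)) (frob_q \<nu> (j + 1)))"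

lemma frobenius_coeff_nonzero_contained:
  assumes \<mu>: "young \<mu>" and \<nu>: "young \<nu>" and d: "diag_squares \<nu> = diag_squares \<mu>"
    and nz: "frobenius_coeff \<mu> \<nu> \<noteq> 0"
  shows "contained \<nu> \<mu>"
proof (rule contained_of_frobenius[OF \<mu> \<nu> d])
  show "frob_p \<nu> (i + 1) \<le> frob_p \<mu> (i + 1)" if "i < diag_squares \<mu>" for i
    by (rule hook_det_nonzero[where a = "\<lambda>i. frob_p \<mu> (i + 1)" and b = "\<lambda>i. frob_p \<nu> (i + 1)" and d = "diag_squares \<mu>"])
      (use nz that frob_p_decreasing[OF \<mu>] frob_p_decreasing[OF \<nu>] in \<open>simp_all add: frobenius_coeff_def d\<close>)
  show "frob_q \<nu> (i + 1) \<le> frob_q \<mu> (i + 1)" if "i < diag_squares \<mu>" for i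
    by (rule hook_det_nonzero[where a = "\<lambda>i. frob_q \<mu> (i + 1)" and b = "\<lambda>i. frob_q \<nu> (i + 1)" and d = "diag_squares \<mu>"])
      (use nz that frob_q_decreasing[OF \<mu>] frob_q_decreasing[OF \<nu>] in \<open>simp_all add: frobenius_coeff_def d\<close>)
qed

text \<open>Rows with nonnegative labels combine rows with nonnegative labels only, because
$(u - \frac12)^{\downarrow p}$ is a polynomial of degree $p$.\<close>

lemma jt_row_falling_nonneg:
  assumes "p < N"
  shows "jt_row falling_fps F (int p) i = (\<Sum>p'<N. const (hook_coeff p p') * jt_row (\<lambda>_. 1) F (int p') i)"
proof -
  have "(\<Sum>p'<N. const (hook_coeff p p') * jt_row (\<lambda>_. 1) F (int p') i) =
      (\<Sum>p'<Suc p. const (hook_coeff p p') * coeff_at F (int p' + int i + 1))"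
    unfolding jt_row_def const_fps_1 mult_1 using assms
    by (intro sum.mono_neutral_right) (auto simp: hook_coeff_def)
  also have "\<dots> = (\<Sum>s<Suc p. fps_nth (const_fps (falling_fps (int p))) s * coeff_at F (int p + int i + 1 - int s))"
    by (rule sum.reindex_bij_witness[of _ "\<lambda>s. p - s" "\<lambda>p'. p - p'"])
      (auto simp: hook_coeff_falling of_nat_diff algebra_simps)
  also have "\<dots> = coeff_at (const_fps (falling_fps (int p)) * F) (int p + int i + 1)"
    by (rule coeff_at_convolution) (simp add: falling_fps_nth_beyond)
  finally show ?thesis by (simp add: jt_row_def)
qed

text \<open>Among the first $n$ columns the series for a negative label can be truncated after $u^{-n}$, since row
$-r - 1$ starts in column $r$.\<close>

lemma jt_row_falling_neg:
  assumes "i < n"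
  shows "jt_row falling_fps F (- int q - 1) i =
    (\<Sum>r<n. const (if q \<le> r then fps_nth (falling_fps (- int q - 1)) (r - q) else 0) * jt_row (\<lambda>_. 1) F (- int r - 1) i)"
proof -
  let ?B = "falling_fps (- int q - 1)"
  have "(\<Sum>r<n. const (if q \<le> r then fps_nth ?B (r - q) else 0) * jt_row (\<lambda>_. 1) F (- int r - 1) i) =
      (\<Sum>r\<in>{q..<n}. const (fps_nth ?B (r - q)) * coeff_at F (int i - int r))"
    unfolding jt_row_def const_fps_1 mult_1
    by (intro sum.mono_neutral_cong_right) (auto simp: algebra_simps)
  also have "\<dots> = (\<Sum>s<n - q. fps_nth (const_fps ?B) s * coeff_at F (int i - int q - int s))"
    by (rule sum.reindex_bij_witness[of _ "\<lambda>s. s + q" "\<lambda>r. r - q"]) (auto simp: of_nat_diff algebra_simps)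
  also have "\<dots> = coeff_at (const_fps ?B * F) (int i - int q)"
  proof (cases "q \<le> n")
    case True
    then show ?thesis using assms by (intro coeff_at_convolution_truncated) (simp add: of_nat_diff)
  qed (use assms in \<open>simp add: coeff_at_def\<close>)
  finally show ?thesis by (simp add: jt_row_def algebra_simps)
qed

text \<open>The coefficients and the $d \times d$ minors provided by \<open>block_change_of_rows\<close> are identified
diagram by diagram: reading \<open>giambelli_rows\<close> backwards for $\nu$ turns a minor into a Schur function, and the
sign $(-1)^{\sum q'_j}$ needed for that is one of those released by the signs in \<open>D\<close>.\<close>

lemma jacobi_trudi_expansion:
  assumes \<mu>: "young \<mu>"
  shows "jacobi_trudi falling_fps H_series \<mu> (length \<mu>) =
    (\<Sum>\<nu>\<in>subdiagrams_same_diag \<mu>. const (frobenius_coeff \<mu> \<nu>) * schur \<nu>)"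
proof -
  define n where "n = length \<mu>"
  define d where "d = diag_squares \<mu>"
  \<comment> \<open>Any bound that exceeds \<open>p\<^sub>1\<close>, and hence every first coordinate of a contained diagram.\<close>
  define N where "N = Suc (row \<mu> 1)"
  define k where "k = (\<lambda>\<nu> j. int (row \<nu> (j + 1)) - int (j + 1))"
  let ?q = "\<lambda>\<nu> j. frob_q \<nu> (j + 1)"
  let ?X = "jt_row (\<lambda>_. 1) H_series" and ?Y = "jt_row falling_fps H_series"
  let ?V = "{\<nu>. young \<nu> \<and> length \<nu> \<le> n \<and> diag_squares \<nu> = d \<and> (\<forall>i<d. frob_p \<nu> (i + 1) < N)}"
  \<comment> \<open>The negative block of the transition matrix and its inverse.\<close>
  define T where "T = (\<lambda>q r. const (if q \<le> r then fps_nth (falling_fps (- int q - 1)) (r - q) else 0))"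
  define D where "D = (\<lambda>r c. const ((-1) ^ (c + r) * hook_coeff c r))"
  have rows: "frobenius_rows n d (k \<nu>) (?q \<nu>)" if "\<nu> \<in> ?V" for \<nu>
    using frobenius_rows_young[of \<nu> n] that by (simp add: k_def)
  have TD: "(\<Sum>r<n. T q r * D r c) = (if c = q then 1 else 0)" if "c < n" for q c
    unfolding T_def D_def const_mult[symmetric] const_sum[symmetric] dual_falling_nth[OF that] by simp
  have det_D: "fdet n D = 1"
  proof -
    have "D i j = 0" if "j < i" for i j using that by (simp add: D_def hook_coeff_def)
    moreover have "D i i = 1" for i by (simp add: D_def hook_coeff_falling flip: mult_2)
    ultimately show ?thesis by (subst fdet_upper_triangular) auto
  qed
  have "fdet n (\<lambda>q. ?X (- int q - 1)) = 1"
    by (subst fdet_upper_triangular) (auto simp: jt_row_neg)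
  then obtain W where W: "\<And>q c. q < n \<Longrightarrow> c < n \<Longrightarrow> (\<Sum>i<n. ?X (- int q - 1) i * W i c) = (if c = q then 1 else 0)"
    and det_W: "fdet n W = 1" by (rule fdet_inverse) blast
  have frob_p_k: "nat (k \<nu> i) = frob_p \<nu> (i + 1)" "k \<nu> i = int (frob_p \<nu> (i + 1))"
    if "young \<nu>" "i < diag_squares \<nu>" for \<nu> i
    using diag_le_row[OF that(1), of "i + 1"] that(2) by (auto simp: k_def frob_p_def of_nat_diff)
  have \<mu>V: "\<mu> \<in> ?V"
  proof -
    have "frob_p \<mu> (i + 1) < N" for i using row_antitone[OF \<mu>, of 1 "i + 1"] by (simp add: frob_p_def N_def)
    then show ?thesis using \<mu> by (simp add: n_def d_def)
  qed
  let ?C = "\<lambda>P. fdet d (\<lambda>i j. const (hook_coeff (nat (k \<mu> i)) (P j)))"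
  let ?E = "\<lambda>Q. fdet d (\<lambda>i j. D (Q i) (?q \<mu> j))"
  let ?g = "\<lambda>q P Q. giambelli_sign d * (-1) ^ (\<Sum>j<d. q j) * fdet d (\<lambda>i j. \<Sum>c<n. ?X (int (P i)) c * W c (Q j))"
  have "jacobi_trudi falling_fps H_series \<mu> n = fdet n (\<lambda>j. ?Y (k \<mu> j))"
    by (simp add: jacobi_trudi_def k_def)
  also have "\<dots> = (\<Sum>P\<in>decreasing_seqs d N. \<Sum>Q\<in>decreasing_seqs d n. ?C P * ?E Q * ?g (?q \<mu>) P Q)"
  proof (rule block_change_of_rows[where X = ?X and Y = ?Y and C = "\<lambda>p p'. const (hook_coeff p p')" and T = T])
    show "k \<mu> i < int N" if "i < d" for i
      using \<mu>V frob_p_k[OF \<mu>, of i] that by (simp add: d_def)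
  qed (use rows[OF \<mu>V] TD det_D W det_W in \<open>auto simp: T_def jt_row_falling_nonneg jt_row_falling_neg\<close>)
  also have "\<dots> = (\<Sum>(P, Q)\<in>decreasing_seqs d N \<times> decreasing_seqs d n. ?C P * ?E Q * ?g (?q \<mu>) P Q)"
    by (simp add: sum.cartesian_product)
  also have "\<dots> = (\<Sum>\<nu>\<in>?V. ?C (frob_p_seq \<nu>) * ?E (frob_q_seq \<nu>) * ?g (?q \<mu>) (frob_p_seq \<nu>) (frob_q_seq \<nu>))"
    by (subst sum.reindex_bij_betw[OF frobenius_bijection, symmetric]) simp
  also have "\<dots> = (\<Sum>\<nu>\<in>?V. const (frobenius_coeff \<mu> \<nu>) * schur \<nu>)"
  proof (rule sum.cong[OF refl])
    fix \<nu> assume \<nu>: "\<nu> \<in> ?V"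
    then have y: "young \<nu>" and dn: "diag_squares \<nu> = d" and l: "length \<nu> \<le> n" by auto
    have C: "?C (frob_p_seq \<nu>) = const (fdet d (\<lambda>i j. hook_coeff (frob_p \<mu> (i + 1)) (frob_p \<nu> (j + 1))))"
      unfolding const_fdet
      by (intro fdet_cong) (simp add: frob_p_k(1)[OF \<mu>] d_def[symmetric] frob_p_seq_def dn)
    have "?E (frob_q_seq \<nu>) = const (fdet d (\<lambda>i j. (-1) ^ ?q \<mu> i * (-1) ^ ?q \<nu> j * hook_coeff (?q \<mu> i) (?q \<nu> j)))"
      unfolding const_fdet
      by (subst fdet_transpose[symmetric]) (intro fdet_cong, simp add: D_def frob_q_seq_def dn power_add)
    also have "\<dots> = (-1) ^ (\<Sum>j<d. ?q \<mu> j) * (-1) ^ (\<Sum>j<d. ?q \<nu> j) *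
        const (fdet d (\<lambda>i j. hook_coeff (?q \<mu> i) (?q \<nu> j)))"
      unfolding fdet_scale power_sum[symmetric] by (simp add: const_mult const_power const_minus)
    finally have E: "?E (frob_q_seq \<nu>) = \<dots>" .
    have "schur \<nu> = fdet n (\<lambda>j. ?X (k \<nu> j))"
      unfolding schur_eq_jacobi_trudi k_def jacobi_trudi_def[symmetric]
      using l by (intro jacobi_trudi_stable[symmetric]) simp_all
    also have "\<dots> = giambelli_sign d * (-1) ^ (\<Sum>j<d. ?q \<nu> j) * fdet d (\<lambda>i j. \<Sum>c<n. ?X (k \<nu> i) c * W c (?q \<nu> j))"
      by (rule giambelli_rows[OF _ det_W rows[OF \<nu>]]) (rule W)
    also have "fdet d (\<lambda>i j. \<Sum>c<n. ?X (k \<nu> i) c * W c (?q \<nu> j)) =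
        fdet d (\<lambda>i j. \<Sum>c<n. ?X (int (frob_p_seq \<nu> i)) c * W c (frob_q_seq \<nu> j))"
      by (intro fdet_cong) (simp add: frob_p_k(2)[OF y] frob_p_seq_def frob_q_seq_def dn)
    finally have S: "schur \<nu> = ?g (?q \<nu>) (frob_p_seq \<nu>) (frob_q_seq \<nu>)" .
    have sq: "(-1) ^ m * ((-1) ^ m * x) = (x :: cpoly)" for m x
      by (simp add: mult.assoc[symmetric] flip: power_mult_distrib)
    show "?C (frob_p_seq \<nu>) * ?E (frob_q_seq \<nu>) * ?g (?q \<mu>) (frob_p_seq \<nu>) (frob_q_seq \<nu>) = const (frobenius_coeff \<mu> \<nu>) * schur \<nu>"
      unfolding C E S frobenius_coeff_def d_def[symmetric] const_mult by (simp add: sq mult_ac)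
  qed
  also have "\<dots> = (\<Sum>\<nu>\<in>subdiagrams_same_diag \<mu>. const (frobenius_coeff \<mu> \<nu>) * schur \<nu>)"
  proof (rule sum.mono_neutral_right)
    show "finite ?V"
      using bij_betw_finite[OF frobenius_bijection[of n d N]] by simp
    show "subdiagrams_same_diag \<mu> \<subseteq> ?V"
    proof
      fix \<nu> assume "\<nu> \<in> subdiagrams_same_diag \<mu>"
      then have y: "young \<nu>" and c: "contained \<nu> \<mu>" and e: "diag_squares \<nu> = d"
        by (auto simp: subdiagrams_same_diag_def d_def)
      have "frob_p \<nu> (i + 1) < N" for i
      proof -
        have "row \<nu> (i + 1) \<le> row \<nu> 1" by (rule row_antitone[OF y]) simp_all
        also have "row \<nu> 1 \<le> row \<mu> 1" using c by (simp add: contained_def)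
        finally show ?thesis by (simp add: frob_p_def N_def)
      qed
      then show "\<nu> \<in> ?V" using y e length_le_of_contained[OF y c] by (simp add: n_def)
    qed
    show "\<forall>\<nu>\<in>?V - subdiagrams_same_diag \<mu>. const (frobenius_coeff \<mu> \<nu>) * schur \<nu> = 0"
    proof
      fix \<nu> assume \<nu>: "\<nu> \<in> ?V - subdiagrams_same_diag \<mu>"
      then have "young \<nu>" "diag_squares \<nu> = diag_squares \<mu>" "\<not> contained \<nu> \<mu>"
        by (auto simp: subdiagrams_same_diag_def d_def)
      then have "frobenius_coeff \<mu> \<nu> = 0" using frobenius_coeff_nonzero_contained[OF \<mu>] by blast
      then show "const (frobenius_coeff \<mu> \<nu>) * schur \<nu> = 0" by simp
    qed
  qed
  finally show ?thesis by (simp add: n_def)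
qed

theorem theorem2p6:
  fixes \<phi> :: "(nat \<Rightarrow> cpoly) \<Rightarrow> cpoly" and \<mu> :: "nat list"
  assumes "frobenius_schur_iso \<phi>" and "young \<mu>"
  shows "\<exists>c :: nat list \<Rightarrow> complex.
    frobenius_schur \<phi> \<mu> = (\<Sum>\<nu> \<in> subdiagrams_same_diag \<mu>. const (c \<nu>) * schur \<nu>) \<and>
    (\<forall>\<nu> \<in> subdiagrams_same_diag \<mu>.
       let d = diag_squares \<mu> in
       c \<nu> = det (mat d d (\<lambda>(i, j). hook_coeff (frob_p \<mu> (i + 1)) (frob_p \<nu> (j + 1)))) *
             det (mat d d (\<lambda>(i, j). hook_coeff (frob_q \<mu> (i + 1)) (frob_q \<nu> (j + 1)))))"
proof (intro exI conjI)
  show "frobenius_schur \<phi> \<mu> = (\<Sum>\<nu>\<in>subdiagrams_same_diag \<mu>. const (frobenius_coeff \<mu> \<nu>) * schur \<nu>)"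
    unfolding frobenius_schur_eq[OF assms(1)] by (rule jacobi_trudi_expansion[OF assms(2)])
qed (simp add: frobenius_coeff_def fdet_def Let_def)

end
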